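(* Let $q\ge5$ be a prime power. (i) Let $R$ be a real chord of $\mathcal C$ meeting $\mathcal C$ in $P_1,P_2$, and let $\Gamma_1,\Gamma_2$ be the $\Gamma$-planes at $P_1,P_2$. Every $2_{\mathcal C}$-plane through $R$ meets one of $\Gamma_1,\Gamma_2$ in its tangent and the other in a non-tangent unisecant. Moreover $\Lambda_{\mathrm{T},2_{\mathcal C}}=\Lambda_{\mathrm{U}\Gamma,2_{\mathcal C}}=1$, $\Pi_{2_{\mathcal C},\mathrm{U}\Gamma}=\Lambda_{\mathrm{U}\Gamma,\overline{1_{\mathcal C}}}=1$, $\Pi_{\overline{1_{\mathcal C}},\mathrm{U}\Gamma}=\Pi_{3_{\mathcal C},\mathrm{U}\Gamma}=(q-1)/2$, $\Lambda_{\mathrm{U}\Gamma,3_{\mathcal C}}=3$, $\Lambda_{\mathrm{Un}\Gamma,2_{\mathcal C}}=2(q-1)$, $\Pi_{2_{\mathcal C},\mathrm{Un}\Gamma}=2$, and, if $q\not\equiv 0\pmod 3$, $\Pi_{2_{\mathcal C},\mathrm{E}\Gamma}=1$ and $\Lambda_{\mathrm{E}\Gamma,2_{\mathcal C}}=q-1$. (ii) Through every tangent there are exactly $q$ planes of type $2_{\mathcal C}$, and no tangent lies in a $3_{\mathcal C}$-plane, a $\overline{1_{\mathcal C}}$-plane or a $0_{\mathcal C}$-plane; i.e. $\Pi_{2_{\mathcal C},\mathrm{T}}=q$ and $\Lambda_{\mathrm{T},\pi}=\Pi_{\pi,\mathrm{T}}=0$ for $\pi\in\{3_{\mathcal C},\overline{1_{\mathcal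 C}},0_{\mathcal C}\}$.
   Context: Let $\mathrm{PG}(3,q)$ have points $\mathbf{P}(x_0,x_1,x_2,x_3)$; put $P(t)=\mathbf{P}(t^3,t^2,t,1)$ ($t\in\mathbb{F}_q$), $P(\infty)=\mathbf{P}(1,0,0,0)$, and let $\mathcal{C}=\{P(t):t\in\mathbb{F}_q\cup\{\infty\}\}$ be the twisted cubic, $G_q$ the group of projectivities fixing $\mathcal C$. Write $\boldsymbol{\pi}(c_0,c_1,c_2,c_3)$ for the plane $c_0x_0+c_1x_1+c_2x_2+c_3x_3=0$. The osculating plane at $P(t)$ is $\boldsymbol{\pi}(1,-3t,3t^2,-t^3)$ ($t\in\mathbb{F}_q$), $\boldsymbol{\pi}(0,0,0,1)$ ($t=\infty$); these are the $\Gamma$-planes. A $d_{\mathcal C}$-plane ($d\in\{0,2,3\}$) contains exactly $d$ points of $\mathcal C$; a $\overline{1_{\mathcal C}}$-plane is a non-$\Gamma$-plane containing exactly one point of $\mathcal C$. For $q\ge5$ these five plane types are exactly the $G_q$-orbits on planes. Lines: a real chord joins two distinct points of $\mathcal C$; the tangent (T-line) at $P(t)$ is the line through $P(t)$ and $\mathbf{P}(3t^2,2t,1,0)$ ($t\in\mathbb{F}_q$), resp. through $P(\infty)$ and $\mathbf{P}(0,1,0,0)$. A unisecant meets $\mathcal C$ in exactly one point; an external line meets it in none. U$\Gamma$-line: non-tangent unisecant lying in a $\Gamma$-plane; Un$\Gamma$-line: unisecant lying in no $\Gamma$-plane; for $q\not\equiv0\pmod 3$, a real axis is the intersection of two distinct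 $\Gamma$-planes and an E$\Gamma$-line is an external line lying in a $\Gamma$-plane that is not a real axis. Notation: for a line type $\lambda$ and plane type $\pi$, $\Lambda_{\lambda,\pi}$ is the number of $\lambda$-lines in a $\pi$-plane (independent of the chosen $\pi$-plane for $q\ge5$), and $\Pi_{\pi,\lambda}$ is the average, over all $\lambda$-lines, of the number of $\pi$-planes containing the line. *)

theory Defs
  imports "HOL-Analysis.Cartesian_Space"
begin

text \<open>
  PG(3,q) is modelled as the lattice of subspaces of the vector space \<open>F\<^sup>4\<close> over a finite field
  \<open>F\<close> with \<open>q = CARD(F)\<close> elements: points, lines and planes are the subspaces of vector dimension
  1, 2 and 3, incidence is inclusion, and two subspaces meet in their intersection.
  The homogeneous coordinates \<open>x\<^sub>0, x\<^sub>1, x\<^sub>2, x\<^sub>3\<close> are the components \<open>1, 2, 3, 4\<close> of a vector.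
  A value of type \<open>'a option\<close> is an element of \<open>F \<union> {\<infinity>}\<close>, with \<open>None\<close> in the role of \<open>\<infinity>\<close>.
\<close>

definition lines :: "('a::field ^ 4) set set" where
  "lines = {l. vec.subspace l \<and> vec.dim l = 2}"

definition planes :: "('a::field ^ 4) set set" where
  "planes = {H. vec.subspace H \<and> vec.dim H = 3}"

definition proj_point :: "'a::field \<Rightarrow> 'a \<Rightarrow> 'a \<Rightarrow> 'a \<Rightarrow> ('a ^ 4) set" where
  "proj_point x0 x1 x2 x3 = vec.span {vector [x0, x1, x2, x3]}"

definition proj_plane :: "'a::field \<Rightarrow> 'a \<Rightarrow> 'a \<Rightarrow> 'a \<Rightarrow> ('a ^ 4) set" where
  "proj_plane c0 c1 c2 c3 = {x. c0 * x $ 1 + c1 * x $ 2 + c2 * x $ 3 + c3 * x $ 4 = 0}"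

definition line_through :: "('a::field ^ 4) set \<Rightarrow> ('a ^ 4) set \<Rightarrow> ('a ^ 4) set" where
  "line_through P Q = vec.span (P \<union> Q)"

fun curve_point :: "'a::field option \<Rightarrow> ('a ^ 4) set" where
  "curve_point (Some t) = proj_point (t ^ 3) (t ^ 2) t 1"
| "curve_point None = proj_point 1 0 0 0"

definition twisted_cubic :: "('a::field ^ 4) set set" where
  "twisted_cubic = range curve_point"

definition curve_points_in :: "('a::field ^ 4) set \<Rightarrow> ('a ^ 4) set set" where
  "curve_points_in X = {P \<in> twisted_cubic. P \<subseteq> X}"

fun osculating_plane :: "'a::field option \<Rightarrow> ('a ^ 4) set" where
  "osculating_plane (Some t) = proj_plane 1 (- 3 * t) (3 * t ^ 2) (- (t ^ 3))"
| "osculating_plane None = proj_plane 0 0 0 1"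

fun tangent :: "'a::field option \<Rightarrow> ('a ^ 4) set" where
  "tangent (Some t) = line_through (curve_point (Some t)) (proj_point (3 * t ^ 2) (2 * t) 1 0)"
| "tangent None = line_through (curve_point None) (proj_point 0 1 0 0)"

definition Gamma_planes :: "('a::field ^ 4) set set" where
  "Gamma_planes = range osculating_plane"

text \<open>The \<open>d\<^sub>C\<close>-planes; only \<open>d \<in> {0, 2, 3}\<close> is a plane type.\<close>

definition dC_planes :: "nat \<Rightarrow> ('a::field ^ 4) set set" where
  "dC_planes d = {H \<in> planes. card (curve_points_in H) = d}"

definition bar1C_planes :: "('a::field ^ 4) set set" where
  "bar1C_planes = {H \<in> planes. H \<notin> Gamma_planes \<and> card (curve_points_in H) = 1}"

definition real_chords :: "('a::field ^ 4) set set" where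
  "real_chords = {line_through P Q | P Q. P \<in> twisted_cubic \<and> Q \<in> twisted_cubic \<and> P \<noteq> Q}"

definition T_lines :: "('a::field ^ 4) set set" where
  "T_lines = range tangent"

definition unisecants :: "('a::field ^ 4) set set" where
  "unisecants = {l \<in> lines. card (curve_points_in l) = 1}"

definition external_lines :: "('a::field ^ 4) set set" where
  "external_lines = {l \<in> lines. curve_points_in l = {}}"

definition UGamma_lines :: "('a::field ^ 4) set set" where
  "UGamma_lines = {l \<in> unisecants. l \<notin> T_lines \<and> (\<exists>G \<in> Gamma_planes. l \<subseteq> G)}"

definition UnGamma_lines :: "('a::field ^ 4) set set" where
  "UnGamma_lines = {l \<in> unisecants. \<not> (\<exists>G \<in> Gamma_planes. l \<subseteq> G)}"

text \<open>Real axes and E\<open>\<Gamma>\<close>-lines are meant for characteristic different from 3 only.\<close>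

definition real_axes :: "('a::field ^ 4) set set" where
  "real_axes = {G1 \<inter> G2 | G1 G2. G1 \<in> Gamma_planes \<and> G2 \<in> Gamma_planes \<and> G1 \<noteq> G2}"

definition EGamma_lines :: "('a::field ^ 4) set set" where
  "EGamma_lines = {l \<in> external_lines. (\<exists>G \<in> Gamma_planes. l \<subseteq> G) \<and> l \<notin> real_axes}"

text \<open>
  For a class \<open>L\<close> of lines and a class \<open>P\<close> of planes, \<open>\<Lambda>\<close> is the number of lines of \<open>L\<close> contained
  in a plane of \<open>P\<close>, which makes sense only if this number is the same for all planes of \<open>P\<close>.
  Therefore \<open>\<Lambda> = n\<close> is expressed by a relation which includes this independence, and the
  existence of a plane in \<open>P\<close>. The first argument only serves to fix the field.
\<close>

definition has_Lambda ::
  "'a::{field,finite} itself \<Rightarrow> ('a ^ 4) set set \<Rightarrow> ('a ^ 4) set set \<Rightarrow> nat \<Rightarrow> bool" where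
  "has_Lambda F L P n \<longleftrightarrow> P \<noteq> {} \<and> (\<forall>H \<in> P. card {l \<in> L. l \<subseteq> H} = n)"

definition avg_Pi ::
  "'a::{field,finite} itself \<Rightarrow> ('a ^ 4) set set \<Rightarrow> ('a ^ 4) set set \<Rightarrow> real" where
  "avg_Pi F P L = (\<Sum>l \<in> L. real (card {H \<in> P. l \<subseteq> H})) / real (card L)"

end

theory Submission
  imports Defs "HOL-Computational_Algebra.Polynomial"
begin

text \<open>
  The plane with coordinate vector \<open>c\<close> corresponds to the binary cubic form with coefficients \<open>c\<close>: its
  curve points are the roots of the form, it contains the tangent at \<open>t\<close> iff \<open>t\<close> is a multiple root, and it is
  the osculating plane at \<open>t\<close> iff \<open>t\<close> is a triple root. Hence a plane through a tangent is either the
  osculating plane or a \<open>2\<^sub>C\<close>-plane, and every \<open>2\<^sub>C\<close>-plane contains exactly one tangent. A line of a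
  non-osculating plane \<open>H\<close> lying in the osculating plane at \<open>t\<close> is the intersection of the two planes, so
  \<open>H\<close> contains one U\<open>\<Gamma>\<close>-line for each of its curve points whose tangent is not in \<open>H\<close>; this gives all the
  \<open>\<Lambda>\<close>'s. Double counting of incidences turns them into averages
  \<open>\<Pi> = \<Lambda> \<cdot> #planes / #lines\<close>. The planes of each type are counted without classifying irreducible
  forms: their numbers \<open>N\<^sub>d\<close> are determined by \<open>N\<^sub>2 = q (q + 1)\<close> (one tangent in each \<open>2\<^sub>C\<close>-plane,
  \<open>q\<close> such planes on each tangent) and by the sums of \<open>1\<close>, \<open>d\<close> and \<open>d\<^sup>2\<close> over all planes.
\<close>

subsection \<open>Subspaces of a finite vector space\<close>

text \<open>Sending \<open>(k, y)\<close> to \<open>k *s b + y\<close> is injective on scalars times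
  \<open>U\<close>: a coincidence with different scalars could be solved for \<open>b\<close> and
  would put it into \<open>U\<close>.\<close>

lemma card_extend_subspace:
  fixes U :: "('a::{field,finite} ^ 'n) set"
  assumes "vec.subspace U" "b \<notin> U"
  shows "card {k *s b + y | k y. y \<in> U} = CARD('a) * card U"
proof -
  have "inj_on (\<lambda>(k, y). k *s b + y) (UNIV \<times> U)"
  proof (rule inj_onI, clarsimp)
    fix k y k' y' assume *: "y \<in> U" "y' \<in> U" "k *s b + y = k' *s b + y'"
    then have d: "(k - k') *s b = y' - y" by (simp add: vec.scale_left_diff_distrib algebra_simps)
    have "k = k'"
    proof (rule ccontr)
      assume "k \<noteq> k'"
      then have "inverse (k - k') * (k - k') = 1" by simp
      then have "b = inverse (k - k') *s ((k - k') *s b)"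
        by (metis vec.scale_one vec.scale_scale)
      also have "\<dots> \<in> U" unfolding d using * assms(1) by (intro vec.subspace_scale vec.subspace_diff)
      finally show False using assms(2) by simp
    qed
    with * show "k = k' \<and> y = y'" by simp
  qed
  moreover have "{k *s b + y | k y. y \<in> U} = (\<lambda>(k, y). k *s b + y) ` (UNIV \<times> U)" by auto
  ultimately show ?thesis by (simp add: card_image card_cartesian_product)
qed

text \<open>Each vector added to an independent set multiplies the size of the span by q. From here
  on dimensions are handled as cardinalities.\<close>

lemma card_subspace:
  fixes S :: "('a::{field,finite} ^ 'n) set"
  assumes "vec.subspace S"
  shows "card S = CARD('a) ^ vec.dim S"
proof -
  have span: "card (vec.span B) = CARD('a) ^ card B" if "vec.independent B" for B :: "('a ^ 'n) set"
  proof -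
    have "finite B" by simp
    then show ?thesis using that
    proof (induction B rule: finite_induct)
      case empty
      then show ?case by simp
    next
      case (insert b B)
      then have "b \<notin> vec.span B" "vec.independent B" by (auto simp: vec.independent_insert)
      moreover have "vec.span (insert b B) = {k *s b + y | k y. y \<in> vec.span B}"
        proof (intro set_eqI iffI)
          fix x assume "x \<in> vec.span (insert b B)"
          then obtain k where "x - k *s b \<in> vec.span B" unfolding vec.span_insert by blast
          then show "x \<in> {k *s b + y | k y. y \<in> vec.span B}"
            by (auto intro!: exI[of _ k] exI[of _ "x - k *s b"])
        next
          fix x assume "x \<in> {k *s b + y | k y. y \<in> vec.span B}"
          then show "x \<in> vec.span (insert b B)" unfolding vec.span_insert
            by clarsimp (metis add_diff_cancel_left')
        qed
      ultimately show ?case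
        using insert card_extend_subspace[OF vec.subspace_span, of b B] by simp
    qed
  qed
  obtain B where B: "B \<subseteq> S" "vec.independent B" "S \<subseteq> vec.span B" "card B = vec.dim S"
    using vec.basis_exists by blast
  then have "vec.span B = S" using assms by (simp add: vec.span_minimal subset_antisym)
  with span[of B] B show ?thesis by simp
qed

section \<open>Hyperplanes and their coordinate vectors\<close>

definition hyperplane :: "'a::field ^ 'n \<Rightarrow> ('a ^ 'n) set" where
  "hyperplane c = {x. scalar_product c x = 0}"

lemma scalar_product_left:
  "scalar_product (x + y) (z::'a::field ^ 'n) = scalar_product x z + scalar_product y z"
  "scalar_product (k *s x) z = k * scalar_product x z"
  by (simp_all add: scalar_product_def algebra_simps sum.distrib sum_distrib_left)

lemma scalar_product_commute: "scalar_product x y = scalar_product y (x::'a::field ^ 'n)"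
  by (simp add: scalar_product_def mult.commute)

lemma scalar_product_right:
  "scalar_product (z::'a::field ^ 'n) (x + y) = scalar_product z x + scalar_product z y"
  "scalar_product z (k *s x) = k * scalar_product z x"
  by (simp_all add: scalar_product_def algebra_simps sum.distrib sum_distrib_left)

lemma mem_hyperplane: "x \<in> hyperplane c \<longleftrightarrow> scalar_product c x = 0"
  by (simp add: hyperplane_def)

lemma subspace_hyperplane: "vec.subspace (hyperplane c)"
proof -
  have "scalar_product c 0 = 0" by (simp add: scalar_product_def)
  then show ?thesis
    by (auto simp: vec.subspace_def mem_hyperplane scalar_product_right)
qed

text \<open>A vector \<open>b\<close> of \<open>S\<close> off the hyperplane is a complement in
  \<open>S\<close>: subtracting a suitable multiple of \<open>b\<close> moves any vector of
  \<open>S\<close> into the hyperplane. This is the only dimension formula used below.\<close>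

lemma card_Int_hyperplane:
  fixes S :: "('a::{field,finite} ^ 'n) set"
  assumes S: "vec.subspace S" and "\<not> S \<subseteq> hyperplane c"
  shows "card S = CARD('a) * card (S \<inter> hyperplane c)"
proof -
  obtain b where b: "b \<in> S" "b \<notin> hyperplane c" using assms(2) by blast
  have "S = {k *s b + y | k y. y \<in> S \<inter> hyperplane c}"
  proof (intro set_eqI iffI)
    fix x assume x: "x \<in> S"
    \<comment> \<open>Chosen so that \<open>c\<close> annihilates \<open>x - k *s b\<close>.\<close>
    define k where "k = scalar_product c x / scalar_product c b"
    have "scalar_product c (x - k *s b) = 0"
      using b scalar_product_right(1)[of c "x - k *s b" "k *s b"]
      by (simp add: mem_hyperplane scalar_product_right k_def)
    moreover have "x - k *s b \<in> S" using x b S by (intro vec.subspace_diff vec.subspace_scale)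
    ultimately show "x \<in> {k *s b + y | k y. y \<in> S \<inter> hyperplane c}"
      by (auto simp: mem_hyperplane intro!: exI[of _ k] exI[of _ "x - k *s b"])
  next
    fix x assume "x \<in> {k *s b + y | k y. y \<in> S \<inter> hyperplane c}"
    then obtain k y where "x = k *s b + y" "y \<in> S" by blast
    then show "x \<in> S" using b(1) S by (simp add: vec.subspace_add vec.subspace_scale)
  qed
  then show ?thesis
    using card_extend_subspace[of "S \<inter> hyperplane c" b] b S
    by (simp add: vec.subspace_inter subspace_hyperplane)
qed

lemma hyperplane_neq_UNIV:
  assumes "c \<noteq> (0::'a::field ^ 'n)"
  shows "\<not> UNIV \<subseteq> hyperplane c"
proof -
  obtain i where "c $ i \<noteq> 0" using assms by (auto simp: vec_eq_iff)
  then have "scalar_product c (axis i 1) \<noteq> 0"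
    by (simp add: scalar_product_def axis_def if_distrib sum.If_cases cong: if_cong)
  then show ?thesis by (auto simp: mem_hyperplane)
qed

text \<open>With \<open>c $ i\<close> nonzero, the test vectors
  \<open>c $ i *s axis j 1 - c $ j *s axis i 1\<close> lie in the hyperplane of \<open>c\<close>;
  that \<open>d\<close> kills them all forces \<open>d\<close> to be proportional to
  \<open>c\<close>.\<close>

lemma hyperplane_eqD:
  fixes c d :: "'a::field ^ 'n"
  assumes "hyperplane c \<subseteq> hyperplane d" "c \<noteq> 0"
  shows "\<exists>k. d = k *s c"
proof -
  obtain i where i: "c $ i \<noteq> 0" using assms by (auto simp: vec_eq_iff)
  have sp: "scalar_product x (axis j 1) = x $ j" for x :: "'a ^ 'n" and j
    by (simp add: scalar_product_def axis_def if_distrib sum.If_cases cong: if_cong)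
  have *: "d $ j = (d $ i / c $ i) * c $ j" for j
  proof -
    define x where "x = c $ i *s axis j 1 + (- c $ j) *s axis i 1"
    have "scalar_product c x = 0"
      unfolding x_def scalar_product_right sp by simp
    then have "scalar_product d x = 0" using assms by (auto simp: mem_hyperplane subset_eq)
    then have "c $ i * d $ j - c $ j * d $ i = 0"
      unfolding x_def scalar_product_right sp by simp
    then show ?thesis using i by (simp add: field_simps)
  qed
  have "d = (d $ i / c $ i) *s c" unfolding vec_eq_iff vector_smult_component using * by blast
  then show ?thesis by blast
qed

subsection \<open>Binary cubic forms\<close>

fun point_vec :: "'a::field option \<Rightarrow> 'a ^ 4" where
  "point_vec (Some t) = vector [t ^ 3, t ^ 2, t, 1]"
| "point_vec None = vector [1, 0, 0, 0]"

text \<open>For a finite parameter, the formal derivative of \<open>point_vec\<close>.\<close>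

fun tangent_vec :: "'a::field option \<Rightarrow> 'a ^ 4" where
  "tangent_vec (Some t) = vector [3 * t ^ 2, 2 * t, 1, 0]"
| "tangent_vec None = vector [0, 1, 0, 0]"

text \<open>The coefficients of the cubic (X - t)^3; at infinity the constant cubic, whose triple
  root is infinity.\<close>

fun osc_vec :: "'a::field option \<Rightarrow> 'a ^ 4" where
  "osc_vec (Some t) = vector [1, - 3 * t, 3 * t ^ 2, - (t ^ 3)]"
| "osc_vec None = vector [0, 0, 0, 1]"

lemma vector_4 [simp]:
  "(vector [a, b, c, d] :: 'a::zero ^ 4) $ 1 = a"
  "(vector [a, b, c, d] :: 'a ^ 4) $ 2 = b"
  "(vector [a, b, c, d] :: 'a ^ 4) $ 3 = c"
  "(vector [a, b, c, d] :: 'a ^ 4) $ 4 = d"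
  by (simp_all add: vector_def)

lemma scalar_product_4:
  "scalar_product c (x::'a::field ^ 4) = c $ 1 * x $ 1 + c $ 2 * x $ 2 + c $ 3 * x $ 3 + c $ 4 * x $ 4"
  by (simp add: scalar_product_def sum_4)

lemma vec4_eq_iff: "c = (d::'a ^ 4) \<longleftrightarrow> c $ 1 = d $ 1 \<and> c $ 2 = d $ 2 \<and> c $ 3 = d $ 3 \<and> c $ 4 = d $ 4"
  by (simp add: vec_eq_iff forall_4)

abbreviation vanishes_at :: "'a::field ^ 4 \<Rightarrow> 'a option \<Rightarrow> bool" where
  "vanishes_at c t \<equiv> scalar_product c (point_vec t) = 0"

text \<open>For finite \<open>t\<close> the second product is the derivative of the cubic at
  \<open>t\<close>, so this is a root of multiplicity at least two, in every characteristic. At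
  infinity it says that the two leading coefficients vanish.\<close>

abbreviation tangent_at :: "'a::field ^ 4 \<Rightarrow> 'a option \<Rightarrow> bool" where
  "tangent_at c t \<equiv> vanishes_at c t \<and> scalar_product c (tangent_vec t) = 0"

lemma osc_vec_point_vec: "vanishes_at (osc_vec t) s \<longleftrightarrow> s = t"
proof (cases t; cases s)
  fix a b :: 'a assume "t = Some a" "s = Some b"
  moreover have "b ^ 3 - 3 * a * b ^ 2 + 3 * a ^ 2 * b - a ^ 3 = (b - a) ^ 3" by algebra
  ultimately show ?thesis by (simp add: scalar_product_4)
qed (simp_all add: scalar_product_4)

lemma osc_vec_tangent_vec: "scalar_product (osc_vec t) (tangent_vec t) = 0"
  by (cases t) (simp_all add: scalar_product_4 power2_eq_square)

text \<open>Finite zeros are roots of the polynomial \<open>p\<close>. Infinity is a zero exactly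
  when the leading coefficient \<open>c $ 1\<close> vanishes, and then the degree of
  \<open>p\<close> is at most 2, so the bound 3 holds in both cases.\<close>

lemma card_zeros_le:
  assumes "c \<noteq> (0::'a::field ^ 4)"
  shows "finite {t. vanishes_at c t} \<and> card {t. vanishes_at c t} \<le> 3"
proof -
  define p where "p = [:c $ 4, c $ 3, c $ 2, c $ 1:]"
  have p0: "p \<noteq> 0" using assms by (auto simp: p_def vec4_eq_iff)
  have v: "vanishes_at c (Some t) \<longleftrightarrow> poly p t = 0" for t
    by (simp add: scalar_product_4 p_def algebra_simps power2_eq_square power3_eq_cube)
  have fin: "finite {t. poly p t = 0}" using p0 by (rule poly_roots_finite)
  have cr: "card {t. poly p t = 0} \<le> degree p" using p0 by (rule card_poly_roots_bound)
  have n: "vanishes_at c None \<longleftrightarrow> c $ 1 = 0" by (simp add: scalar_product_4)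
  have "{t. vanishes_at c t} = Some ` {t. poly p t = 0} \<union> (if c $ 1 = 0 then {None} else {})"
    (is "?Z = ?S \<union> ?N")
  proof (intro set_eqI)
    show "t \<in> ?Z \<longleftrightarrow> t \<in> ?S \<union> ?N" for t using n v by (cases t) auto
  qed
  moreover have "card (?S \<union> ?N) \<le> degree p + card ?N"
    using card_Un_le[of ?S ?N] cr by (simp add: card_image)
  moreover have "degree p + card ?N \<le> 3"
    by (auto simp: p_def)
  ultimately show ?thesis using fin by auto
qed

text \<open>A double root at \<open>a\<close> expresses the two lower coefficients by the two upper
  ones; then (X - a)^2 splits off the cubic and X - a splits off its derivative.\<close>

lemma tangent_at_SomeD:
  fixes c :: "'a::field ^ 4"
  assumes "tangent_at c (Some a)"
  shows "c $ 3 = - 3 * c $ 1 * a ^ 2 - 2 * c $ 2 * a" "c $ 4 = 2 * c $ 1 * a ^ 3 + c $ 2 * a ^ 2"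
    "scalar_product c (point_vec (Some b)) = (b - a) ^ 2 * (c $ 1 * (b + 2 * a) + c $ 2)"
    "scalar_product c (tangent_vec (Some b)) = (b - a) * (c $ 1 * (3 * b + 3 * a) + 2 * c $ 2)"
proof -
  have 1: "c $ 1 * a ^ 3 + c $ 2 * a ^ 2 + c $ 3 * a + c $ 4 = 0"
    and 2: "3 * c $ 1 * a ^ 2 + 2 * c $ 2 * a + c $ 3 = 0"
    using assms by (simp_all add: scalar_product_4 mult_ac)
  from 2 show 3: "c $ 3 = - 3 * c $ 1 * a ^ 2 - 2 * c $ 2 * a" by algebra
  from 1 2 show 4: "c $ 4 = 2 * c $ 1 * a ^ 3 + c $ 2 * a ^ 2" by algebra
  show "scalar_product c (point_vec (Some b)) = (b - a) ^ 2 * (c $ 1 * (b + 2 * a) + c $ 2)"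
    "scalar_product c (tangent_vec (Some b)) = (b - a) * (c $ 1 * (3 * b + 3 * a) + 2 * c $ 2)"
    by (simp_all add: scalar_product_4 3 4 algebra_simps power2_eq_square power3_eq_cube)
qed

text \<open>The multiplicities 2 + 1 + 1 exceed the degree 3. For a finite double root this is seen
  on the linear cofactor \<open>c $ 1 * (b + 2 * a) + c $ 2\<close>, which would vanish at both
  other parameters.\<close>

lemma tangent_and_two_points:
  fixes c :: "'a::field ^ 4"
  assumes "tangent_at c t" "vanishes_at c u" "vanishes_at c v" "u \<noteq> t" "v \<noteq> t" "u \<noteq> v"
  shows "c = 0"
proof (cases t)
  case None
  with assms obtain a b where [simp]: "u = Some a" "v = Some b" by (cases u; cases v) auto
  have ab: "a \<noteq> b" using assms by auto
  have eq: "c $ 1 = 0" "c $ 2 = 0" "c $ 3 * a + c $ 4 = 0" "c $ 3 * b + c $ 4 = 0"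
    using assms None by (simp_all add: scalar_product_4)
  then have "c $ 3 * (a - b) = 0" by algebra
  with ab eq show ?thesis by (simp add: vec4_eq_iff)
next
  case (Some a)
  note * = tangent_at_SomeD[OF assms(1)[unfolded Some]]
  have zero: ?thesis if "c $ 1 = 0" "c $ 2 = 0" using that * by (simp add: vec4_eq_iff)
  have factor: "c $ 1 * (b + 2 * a) + c $ 2 = 0" if "vanishes_at c (Some b)" "b \<noteq> a" for b
    using that *(3)[of b] by auto
  have infinite: ?thesis if "vanishes_at c None" "vanishes_at c (Some b)" "b \<noteq> a" for b
  proof (rule zero)
    show "c $ 1 = 0" using that(1) by (simp add: scalar_product_4)
    then show "c $ 2 = 0" using factor that by auto
  qed
  consider b where "u = None" "v = Some b" | b where "v = None" "u = Some b" | b d where "u = Some b" "v = Some d"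
    using assms by (cases u; cases v) auto
  then show ?thesis
  proof cases
    case 3
    with assms have "b \<noteq> d" by auto
    from 3 assms Some have "c $ 1 * (b + 2 * a) + c $ 2 = 0" "c $ 1 * (d + 2 * a) + c $ 2 = 0"
      by (auto intro!: factor)
    moreover from this have "c $ 1 * (b - d) = 0" by algebra
    ultimately show ?thesis using \<open>b \<noteq> d\<close> by (intro zero) auto
  qed (use infinite assms Some in auto)
qed

text \<open>The multiplicities 2 + 2 exceed the degree 3.\<close>

lemma two_tangents:
  fixes c :: "'a::field ^ 4"
  assumes "tangent_at c t" "tangent_at c u" "u \<noteq> t"
  shows "c = 0"
proof -
  consider b where "u = None" "t = Some b" | b where "t = None" "u = Some b" | a b where "t = Some a" "u = Some b"
    using assms by (cases u; cases t) auto
  then show ?thesis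
  proof cases
    case 3
    then have "b \<noteq> a" using assms by auto
    note * = tangent_at_SomeD[OF assms(1)[unfolded 3]]
    have eqs: "c $ 1 * (b + 2 * a) + c $ 2 = 0" "c $ 1 * (3 * b + 3 * a) + 2 * c $ 2 = 0"
      using *(3,4)[of b] assms 3 \<open>b \<noteq> a\<close> by auto
    \<comment> \<open>The second equation minus twice the first; no division by 2 or 3 occurs, so
      characteristics 2 and 3 are covered.\<close>
    then have "c $ 1 * (b - a) = 0" by algebra
    then have "c $ 1 = 0" using \<open>b \<noteq> a\<close> by simp
    with eqs * show ?thesis by (simp add: vec4_eq_iff)
  qed (use assms in \<open>auto simp: scalar_product_4 vec4_eq_iff\<close>)
qed

text \<open>The cubic form has a third root, which is either new or repeats one of the two given ones.\<close>

lemma two_zeros_cases: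
  assumes "vanishes_at c t" "vanishes_at c u" "u \<noteq> t" "c \<noteq> 0"
  obtains v where "v \<noteq> t" "v \<noteq> u" "vanishes_at c v" | "tangent_at c t" | "tangent_at c u"
proof -
  have infinite: "tangent_at c None \<or> tangent_at c (Some a) \<or> (\<exists>v. v \<noteq> None \<and> v \<noteq> Some a \<and> vanishes_at c v)"
    if "vanishes_at c None" "vanishes_at c (Some a)" for a
  proof (cases "c $ 2 = 0")
    case True
    with that show ?thesis by (simp add: scalar_product_4)
  next
    case False
    \<comment> \<open>With a root at infinity the form is quadratic, and \<open>v\<close> is its
      second finite root, read off from the sum of the roots.\<close>
    define v where "v = - c $ 3 / c $ 2 - a"
    have *: "c $ 3 = - c $ 2 * (v + a)" using False by (simp add: v_def)
    have "vanishes_at c (Some v)" using that False * by (simp add: scalar_product_4) algebra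
    moreover have "tangent_at c (Some a)" if "v = a"
      using that \<open>vanishes_at c None\<close> \<open>vanishes_at c (Some a)\<close> * by (simp add: scalar_product_4)
    ultimately show ?thesis by (cases "v = a") blast+
  qed
  have finite: "tangent_at c (Some a) \<or> tangent_at c (Some b) \<or> (\<exists>v. v \<noteq> Some a \<and> v \<noteq> Some b \<and> vanishes_at c v)"
    if ab: "vanishes_at c (Some a)" "vanishes_at c (Some b)" "a \<noteq> b" for a b
  proof (cases "c $ 1 = 0")
    case True
    \<comment> \<open>A vanishing leading coefficient makes infinity the third root.\<close>
    then show ?thesis by (intro disjI2 exI[of _ None]) (simp add: scalar_product_4)
  next
    case False
    \<comment> \<open>The third root, from the sum -c_2/c_1 of the roots; the remaining coefficients
      then follow Vieta's formulas.\<close>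
    define v where "v = - c $ 2 / c $ 1 - a - b"
    have 2: "c $ 2 = - c $ 1 * (v + a + b)" using False by (simp add: v_def)
    have 3: "c $ 3 = c $ 1 * (v * a + v * b + a * b)" and 4: "c $ 4 = - c $ 1 * v * a * b"
      using ab 2 by (simp_all add: scalar_product_4) algebra+
    have "vanishes_at c (Some v)" by (simp add: scalar_product_4 2 3 4) algebra
    moreover have "tangent_at c (Some a)" if "v = a"
      unfolding scalar_product_4 2 3 4
      by (simp add: that algebra_simps power2_eq_square power3_eq_cube)
    moreover have "tangent_at c (Some b)" if "v = b"
      unfolding scalar_product_4 2 3 4
      by (simp add: that algebra_simps power2_eq_square power3_eq_cube)
    ultimately show ?thesis by (cases "v = a"; cases "v = b") blast+
  qed
  show thesis
    using assms finite infinite that by (cases t; cases u) (simp; metis)+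
qed

text \<open>After splitting off the double root a linear factor remains. Its root is either
  \<open>t\<close> again, which gives a multiple of the cube, or a new zero.\<close>

lemma tangent_cases:
  assumes "tangent_at c t" "c \<noteq> 0"
  obtains k where "c = k *s osc_vec t" | u where "u \<noteq> t" "vanishes_at c u"
proof (cases t)
  case [simp]: None
  show thesis
  proof (cases "c $ 3 = 0")
    case True
    then have "c = c $ 4 *s osc_vec t"
      using assms by (simp add: scalar_product_4 vec4_eq_iff)
    then show thesis by (rule that)
  next
    case False
    then have "vanishes_at c (Some (- c $ 4 / c $ 3))" using assms by (simp add: scalar_product_4)
    then show thesis by (rule that(2)[rotated]) simp
  qed
next
  case [simp]: (Some a)
  show thesis
  proof (cases "c $ 1 = 0")
    case True
    then show thesis using that(2)[of None] by (simp add: scalar_product_4)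
  next
    case False
    \<comment> \<open>The roots are \<open>a\<close>, \<open>a\<close> and \<open>v\<close>, so
      their sum -c_2/c_1 determines \<open>v\<close>.\<close>
    define v where "v = - c $ 2 / c $ 1 - 2 * a"
    have 2: "c $ 2 = - c $ 1 * (v + 2 * a)" using False by (simp add: v_def)
    have 3: "c $ 3 = c $ 1 * (2 * v * a + a ^ 2)" and 4: "c $ 4 = - c $ 1 * v * a ^ 2"
      using tangent_at_SomeD(1,2)[OF assms(1)[unfolded Some]]
      by (simp_all add: 2 algebra_simps power2_eq_square power3_eq_cube)
    have v: "vanishes_at c (Some v)"
      by (simp add: scalar_product_4 2 3 4 power2_eq_square power3_eq_cube algebra_simps)
    show thesis
    proof (cases "v = a")
      case True
      with 2 3 4 have "c = c $ 1 *s osc_vec t"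
        by (simp add: vec4_eq_iff power2_eq_square power3_eq_cube algebra_simps)
      then show thesis by (rule that)
    next
      case False
      then show thesis using that(2)[OF _ v] by simp
    qed
  qed
qed

text \<open>Read as a function of \<open>t\<close>, the product of \<open>osc_vec t\<close> with a point of the tangent at \<open>s\<close> is a
  cubic form with a double root at \<open>s\<close>. In characteristic 3 it degenerates to \<open>\<alpha> (s - t)^3\<close>.\<close>

lemma osculating_tangent_meet:
  assumes three: "(3::'a::field) \<noteq> 0" and "distinct [s, a, b]"
    and x: "x = \<alpha> *s point_vec s + \<beta> *s tangent_vec s"
    and "scalar_product (osc_vec a) x = 0" "scalar_product (osc_vec b) (x::'a ^ 4) = 0"
  shows "x = 0"
proof -
  have "\<alpha> = 0 \<and> \<beta> = 0"
  proof (cases s)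
    case None
    with assms obtain t u where [simp]: "a = Some t" "b = Some u" by (cases a; cases b) auto
    have "t \<noteq> u" "\<alpha> - 3 * t * \<beta> = 0" "\<alpha> - 3 * u * \<beta> = 0"
      using assms None by (auto simp: scalar_product_4 scalar_product_right)
    \<comment> \<open>The difference of the two equations is 3 (t - u) \<beta> = 0 up to sign; this
      is where 3 must be invertible.\<close>
    with three have "\<beta> = 0" by algebra
    with \<open>\<alpha> - 3 * t * \<beta> = 0\<close> show ?thesis by simp
  next
    case (Some r)
    have e: "scalar_product (osc_vec (Some t)) x = (r - t) ^ 2 * (\<alpha> * (r - t) + 3 * \<beta>)" for t
      unfolding x Some scalar_product_right by (simp add: scalar_product_4) algebra
    have f: "scalar_product (osc_vec None) x = \<alpha>"
      unfolding x Some scalar_product_right by (simp add: scalar_product_4)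
    have g: "\<alpha> * (r - t) + 3 * \<beta> = 0" if "scalar_product (osc_vec (Some t)) x = 0" "r \<noteq> t" for t
      using that e by auto
    consider t u where "a = Some t" "b = Some u" | u where "a = None" "b = Some u" | t where "a = Some t" "b = None"
      using assms by (cases a; cases b) auto
    then show ?thesis
    proof cases
      case 1
      then have "r \<noteq> t" "r \<noteq> u" "t \<noteq> u" using assms Some by auto
      then have "\<alpha> * (r - t) + 3 * \<beta> = 0" "\<alpha> * (r - u) + 3 * \<beta> = 0"
        using g 1 assms by auto
      then have "\<alpha> * (u - t) = 0" by algebra
      with \<open>t \<noteq> u\<close> have "\<alpha> = 0" by simp
      then show ?thesis using \<open>\<alpha> * (r - t) + 3 * \<beta> = 0\<close> three by simp
    next
      case 2
      then show ?thesis using f g[of u] three assms Some by auto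
    next
      case 3
      then show ?thesis using f g[of t] three assms Some by auto
    qed
  qed
  then show ?thesis unfolding x by simp
qed

subsection \<open>Counting lines and planes\<close>

lemma two_le_CARD: "2 \<le> CARD('a::{field,finite})"
proof -
  have "card {0::'a, 1} \<le> CARD('a)" by (rule card_mono) auto
  then show ?thesis by simp
qed

lemma dim_eq_iff_card:
  fixes S :: "('a::{field,finite} ^ 'n) set"
  assumes "vec.subspace S"
  shows "vec.dim S = k \<longleftrightarrow> card S = CARD('a) ^ k"
  using card_subspace[OF assms] two_le_CARD[where 'a='a] by (simp add: power_inject_exp)

lemma lines_iff:
  "l \<in> lines \<longleftrightarrow> vec.subspace l \<and> card (l::('a::{field,finite} ^ 4) set) = CARD('a) ^ 2"
  by (auto simp: lines_def dim_eq_iff_card)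

lemma planes_iff:
  "H \<in> planes \<longleftrightarrow> vec.subspace H \<and> card (H::('a::{field,finite} ^ 4) set) = CARD('a) ^ 3"
  by (auto simp: planes_def dim_eq_iff_card)

text \<open>Each linear condition divides the number of solutions by at most q. This replaces rank
  arguments by counting.\<close>

lemma card_annihilator_ge:
  fixes B :: "('a::{field,finite} ^ 'n) set"
  shows "CARD('a) ^ CARD('n) \<le> CARD('a) ^ card B * card {c. \<forall>b\<in>B. scalar_product c b = 0}"
proof -
  have "finite B" by simp
  then show ?thesis
  proof (induction B rule: finite_induct)
    case (insert b B)
    let ?A = "{c. \<forall>b\<in>B. scalar_product c b = 0}"
    have "?A = (\<Inter>b\<in>B. hyperplane b)"
      by (auto simp: mem_hyperplane scalar_product_commute)
    then have sub: "vec.subspace ?A"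
      by (simp only:) (intro vec.subspace_Inter; auto simp: subspace_hyperplane)
    have "{c. \<forall>b\<in>insert b B. scalar_product c b = 0} = ?A \<inter> hyperplane b"
      by (auto simp: mem_hyperplane scalar_product_commute)
    moreover have "card ?A \<le> CARD('a) * card (?A \<inter> hyperplane b)"
    proof (cases "?A \<subseteq> hyperplane b")
      case True
      then have "?A \<inter> hyperplane b = ?A" by blast
      then show ?thesis by (simp del: mem_Collect_eq)
    qed (simp add: card_Int_hyperplane[OF sub])
    ultimately have "CARD('a) ^ card B * card ?A
        \<le> CARD('a) ^ card B * (CARD('a) * card {c. \<forall>b\<in>insert b B. scalar_product c b = 0})"
      by (simp only: mult_le_mono2)
    from le_trans[OF insert.IH this] insert.hyps show ?case by (simp add: mult_ac)
  qed simp
qed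

lemma hyperplane_in_planes:
  assumes "c \<noteq> (0::'a::{field,finite} ^ 4)"
  shows "hyperplane c \<in> planes"
  using card_Int_hyperplane[OF vec.subspace_UNIV hyperplane_neq_UNIV[OF assms]]
  by (simp add: planes_iff subspace_hyperplane power4_eq_xxxx power3_eq_cube)

text \<open>At most three homogeneous conditions on four coordinates leave at least q solutions,
  hence a nonzero one.\<close>

lemma ex_hyperplane_containing:
  fixes B :: "('a::{field,finite} ^ 4) set"
  assumes "card B \<le> 3"
  obtains c where "c \<noteq> 0" "B \<subseteq> hyperplane c"
proof -
  let ?A = "{c. \<forall>b\<in>B. scalar_product c b = 0}"
  have "CARD('a) ^ 3 * CARD('a) \<le> CARD('a) ^ card B * card ?A"
    using card_annihilator_ge[of B] by (simp add: power4_eq_xxxx power3_eq_cube)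
  also have "\<dots> \<le> CARD('a) ^ 3 * card ?A"
    using assms by (intro mult_le_mono1 power_increasing) auto
  finally have "2 \<le> card ?A" using two_le_CARD[where 'a='a] by simp
  then have "\<not> ?A \<subseteq> {0}" using card_mono[of "{0}" ?A] by auto
  then obtain c where "c \<in> ?A" "c \<noteq> 0" by blast
  then show thesis by (intro that[of c]) (auto simp: mem_hyperplane)
qed

text \<open>A basis of \<open>H\<close> lies in some hyperplane with nonzero coordinates; it
  contains \<open>H\<close> and has the same size, so it is \<open>H\<close>.\<close>

lemma planesE:
  assumes "H \<in> (planes :: ('a::{field,finite} ^ 4) set set)"
  obtains c where "c \<noteq> 0" "H = hyperplane c"
proof -
  obtain B where B: "B \<subseteq> H" "H \<subseteq> vec.span B" "card B = vec.dim H"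
    by (rule vec.basis_exists[of H])
  have "card B \<le> 3" using B(3) assms by (simp add: planes_def)
  then obtain c where c: "c \<noteq> 0" "B \<subseteq> hyperplane c" by (rule ex_hyperplane_containing)
  have "H \<subseteq> hyperplane c" using B(2) c(2) vec.span_minimal[OF _ subspace_hyperplane] by blast
  then have "H = hyperplane c"
    using assms hyperplane_in_planes[OF c(1)] by (simp add: planes_iff card_subset_eq)
  with c(1) show thesis by (rule that)
qed

section \<open>Incidence and numbers of lines\<close>

lemma lines_subset_eq:
  assumes "l \<in> lines" "m \<in> lines" "l \<subseteq> (m::('a::{field,finite} ^ 4) set)"
  shows "l = m"
  using assms by (simp add: lines_iff card_subset_eq)

lemma planes_subset_eq:
  assumes "H \<in> planes" "K \<in> planes" "H \<subseteq> (K::('a::{field,finite} ^ 4) set)"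
  shows "H = K"
  using assms by (simp add: planes_iff card_subset_eq)

lemma Int_planes:
  assumes "H \<in> planes" "K \<in> planes" "H \<noteq> (K::('a::{field,finite} ^ 4) set)"
  shows "H \<inter> K \<in> lines"
proof -
  obtain c where c: "K = hyperplane c" using assms(2) by (rule planesE)
  have "\<not> H \<subseteq> K" using planes_subset_eq assms by blast
  then have "card H = CARD('a) * card (H \<inter> K)"
    using card_Int_hyperplane[of H c] assms c by (simp add: planes_iff)
  then show ?thesis
    using assms by (simp add: planes_iff lines_iff vec.subspace_inter power2_eq_square power3_eq_cube)
qed

lemma span_pair_in_lines:
  assumes "x \<noteq> 0" "y \<notin> vec.span {x::'a::field ^ 4}"
  shows "vec.span {x, y} \<in> lines"
proof -
  have "vec.dim {y, x} = 2" using assms by (simp add: vec.dim_insert)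
  then show ?thesis by (simp add: lines_def insert_commute)
qed

lemma line_eq_span_pair:
  assumes "l \<in> lines" "x \<in> l" "y \<in> l" "x \<noteq> 0" "y \<notin> vec.span {x::'a::{field,finite} ^ 4}"
  shows "l = vec.span {x, y}"
proof -
  have "vec.span {x, y} \<subseteq> l"
    using assms by (intro vec.span_minimal) (auto simp: lines_def)
  then show ?thesis using lines_subset_eq[OF span_pair_in_lines] assms by metis
qed

lemma card_span_singleton:
  assumes "x \<noteq> (0::'a::{field,finite} ^ 'n)"
  shows "card (vec.span {x}) = CARD('a)"
  using dim_eq_iff_card[OF vec.subspace_span, of "{x}" 1] assms by simp

text \<open>Double counting of pairs of a line through \<open>x\<close> and a vector on it outside
  the span of \<open>x\<close>: every such vector of \<open>S\<close> determines exactly one line,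
  and every line carries q^2 - q such vectors.\<close>

lemma card_lines_through:
  fixes x :: "'a::{field,finite} ^ 4"
  assumes S: "vec.subspace S" and x: "x \<in> S" "x \<noteq> 0"
  shows "card {l \<in> lines. x \<in> l \<and> l \<subseteq> S} * (CARD('a) ^ 2 - CARD('a)) = card S - CARD('a)"
proof -
  let ?L = "{l \<in> lines. x \<in> l \<and> l \<subseteq> S}" and ?Y = "S - vec.span {x}"
  have sx: "vec.span {x} \<subseteq> V" if "vec.subspace V" "x \<in> V" for V
    using that by (intro vec.span_minimal) auto
  have 1: "{l \<in> ?L. y \<in> l} = {vec.span {x, y}}" if "y \<in> ?Y" for y
  proof -
    have "vec.span {x, y} \<in> ?L"
      using that x S span_pair_in_lines[of x y] vec.span_minimal[of "{x, y}" S] by (auto intro: vec.span_base)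
    moreover have "l = vec.span {x, y}" if "l \<in> ?L" "y \<in> l" for l
      using that \<open>y \<in> ?Y\<close> x line_eq_span_pair[of l x y] by auto
    ultimately show ?thesis by (auto intro: vec.span_base)
  qed
  have 2: "card {y \<in> ?Y. y \<in> l} = CARD('a) ^ 2 - CARD('a)" if "l \<in> ?L" for l
  proof -
    have "{y \<in> ?Y. y \<in> l} = l - vec.span {x}" using that by auto
    then show ?thesis
      using that sx[of l] x by (simp add: card_Diff_subset card_span_singleton lines_iff)
  qed
  have "(\<Sum>y\<in>?Y. card {l \<in> ?L. y \<in> l}) = (CARD('a) ^ 2 - CARD('a)) * card ?L"
    using 2 by (intro sum_multicount) auto
  moreover have "(\<Sum>y\<in>?Y. card {l \<in> ?L. y \<in> l}) = card ?Y" using 1 by (subst sum.cong[OF refl, where h = "\<lambda>_. 1"]) auto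
  moreover have "card ?Y = card S - CARD('a)"
    using sx[OF S] x by (simp add: card_Diff_subset card_span_singleton)
  ultimately show ?thesis by (simp only: mult.commute)
qed

lemma card_lines_through_in_plane:
  fixes x :: "'a::{field,finite} ^ 4"
  assumes "H \<in> planes" "x \<in> H" "x \<noteq> 0"
  shows "card {l \<in> lines. x \<in> l \<and> l \<subseteq> H} = CARD('a) + 1"
proof -
  \<comment> \<open>Substituting q = m + 2 removes the truncated subtractions and leaves polynomial
    identities over the naturals.\<close>
  obtain m where m: "CARD('a) = m + 2" using two_le_CARD[where 'a='a] by (metis add.commute le_Suc_ex)
  have "card {l \<in> lines. x \<in> l \<and> l \<subseteq> H} * (CARD('a) ^ 2 - CARD('a)) = (CARD('a) + 1) * (CARD('a) ^ 2 - CARD('a))"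
    using card_lines_through[of H x] assms unfolding planes_iff
    by (simp add: m power2_eq_square power3_eq_cube algebra_simps)
  moreover have "CARD('a) ^ 2 - CARD('a) \<noteq> 0" by (simp add: m power2_eq_square)
  ultimately show ?thesis by (simp only: mult_cancel_right simp_thms)
qed

lemma card_lines_through_point:
  fixes x :: "'a::{field,finite} ^ 4"
  assumes "x \<noteq> 0"
  shows "card {l \<in> lines. x \<in> l} = CARD('a) ^ 2 + CARD('a) + 1"
proof -
  obtain m where m: "CARD('a) = m + 2" using two_le_CARD[where 'a='a] by (metis add.commute le_Suc_ex)
  have "card {l \<in> lines. x \<in> l} * (CARD('a) ^ 2 - CARD('a))
      = (CARD('a) ^ 2 + CARD('a) + 1) * (CARD('a) ^ 2 - CARD('a))"
    using card_lines_through[OF vec.subspace_UNIV, of x] assms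
    by (simp add: m power2_eq_square power4_eq_xxxx algebra_simps)
  moreover have "CARD('a) ^ 2 - CARD('a) \<noteq> 0" by (simp add: m power2_eq_square)
  ultimately show ?thesis by (simp only: mult_cancel_right simp_thms)
qed

lemma card_nonzero:
  fixes S :: "('a::{field,finite} ^ 'n) set"
  assumes "vec.subspace S"
  shows "card (S - {0}) = card S - 1"
  using vec.subspace_0[OF assms] by simp

text \<open>Double counting of nonzero vectors of \<open>H\<close> against lines of
  \<open>H\<close>, with q + 1 lines through each vector.\<close>

lemma card_lines_in_plane:
  assumes H: "H \<in> (planes :: ('a::{field,finite} ^ 4) set set)"
  shows "card {l \<in> lines. l \<subseteq> H} = CARD('a) ^ 2 + CARD('a) + 1"
proof -
  let ?L = "{l \<in> lines. l \<subseteq> H}"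
  obtain m where m: "CARD('a) = m + 2" using two_le_CARD[where 'a='a] by (metis add.commute le_Suc_ex)
  have 1: "card {l \<in> ?L. y \<in> l} = CARD('a) + 1" if "y \<in> H - {0}" for y
  proof -
    have "{l \<in> ?L. y \<in> l} = {l \<in> lines. y \<in> l \<and> l \<subseteq> H}" by auto
    then show ?thesis using card_lines_through_in_plane[OF H, of y] that by simp
  qed
  have 2: "card {y \<in> H - {0}. y \<in> l} = CARD('a) ^ 2 - 1" if "l \<in> ?L" for l
  proof -
    have "{y \<in> H - {0}. y \<in> l} = l - {0}" using that by auto
    then show ?thesis using that card_nonzero[of l] by (simp add: lines_iff)
  qed
  have "(\<Sum>y\<in>H - {0}. card {l \<in> ?L. y \<in> l}) = (CARD('a) ^ 2 - 1) * card ?L"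
    using 2 by (intro sum_multicount) auto
  then have "(CARD('a) ^ 2 - 1) * card ?L = (CARD('a) ^ 3 - 1) * (CARD('a) + 1)"
    using 1 H card_nonzero[of H] by (simp add: planes_iff)
  also have "\<dots> = (CARD('a) ^ 2 - 1) * (CARD('a) ^ 2 + CARD('a) + 1)"
    by (simp add: m power2_eq_square power3_eq_cube algebra_simps)
  finally have "(CARD('a) ^ 2 - 1) * card ?L = (CARD('a) ^ 2 - 1) * (CARD('a) ^ 2 + CARD('a) + 1)" .
  moreover have "CARD('a) ^ 2 - 1 \<noteq> 0" by (simp add: m power2_eq_square)
  ultimately show ?thesis by (simp only: mult_cancel_left simp_thms)
qed

text \<open>Every plane has exactly q - 1 nonzero coordinate vectors, the multiples of one of them.
  So planes through \<open>U\<close> are counted by the nonzero vectors annihilating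
  \<open>U\<close>; the 1 subtracted on the right is the zero vector.\<close>

lemma card_planes_containing:
  fixes U :: "('a::{field,finite} ^ 4) set"
  shows "(CARD('a) - 1) * card {H \<in> planes. U \<subseteq> H} = card {c. U \<subseteq> hyperplane c} - 1"
proof -
  let ?P = "{H \<in> planes. U \<subseteq> H}" and ?C = "{c. U \<subseteq> hyperplane c} - {0}"
  have 1: "{H \<in> ?P. hyperplane c = H} = {hyperplane c}" if "c \<in> ?C" for c
    using that hyperplane_in_planes by auto
  have 2: "card {c \<in> ?C. hyperplane c = H} = CARD('a) - 1" if "H \<in> ?P" for H
  proof -
    have "H \<in> planes" using that by simp
    then obtain d where d: "d \<noteq> 0" "H = hyperplane d" by (rule planesE)
    have eq: "hyperplane (k *s d) = hyperplane d" if "k \<noteq> 0" for k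
      using that by (auto simp: mem_hyperplane scalar_product_left)
    have "{c \<in> ?C. hyperplane c = H} = (\<lambda>k. k *s d) ` (UNIV - {0})"
    proof (intro set_eqI iffI)
      fix c assume c: "c \<in> {c \<in> ?C. hyperplane c = H}"
      then obtain k where "c = k *s d" using hyperplane_eqD[of d c] d by auto
      then show "c \<in> (\<lambda>k. k *s d) ` (UNIV - {0})" using c by auto
    next
      fix c assume "c \<in> (\<lambda>k. k *s d) ` (UNIV - {0})"
      then show "c \<in> {c \<in> ?C. hyperplane c = H}" using eq d that by (auto simp: vec.scale_eq_0_iff)
    qed
    moreover have "inj (\<lambda>k. k *s d)" using d by (auto simp: inj_on_def)
    ultimately show ?thesis by (simp add: card_image inj_on_subset card_Diff_subset)
  qed
  have "(\<Sum>c\<in>?C. card {H \<in> ?P. hyperplane c = H}) = (CARD('a) - 1) * card ?P"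
    using 2 by (intro sum_multicount) auto
  moreover have "(\<Sum>c\<in>?C. card {H \<in> ?P. hyperplane c = H}) = card ?C"
    using 1 by (subst sum.cong[OF refl, where h = "\<lambda>_. 1"]) auto
  moreover have "card ?C = card {c. U \<subseteq> hyperplane c} - 1"
    by (simp add: mem_hyperplane scalar_product_def subset_eq)
  ultimately show ?thesis by simp
qed

section \<open>Numbers of planes through given points\<close>

lemma card_hyperplane:
  "c \<noteq> (0::'a::{field,finite} ^ 4) \<Longrightarrow> card (hyperplane c) = CARD('a) ^ 3"
  using hyperplane_in_planes by (auto simp: planes_iff)

lemma card_planes: "card (planes :: ('a::{field,finite} ^ 4) set set) = CARD('a) ^ 3 + CARD('a) ^ 2 + CARD('a) + 1"
proof -
  obtain m where m: "CARD('a) = m + 2" using two_le_CARD[where 'a='a] by (metis add.commute le_Suc_ex)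
  have "(CARD('a) - 1) * card (planes :: ('a ^ 4) set set) = CARD('a) ^ 4 - 1"
    using card_planes_containing[of "{}::('a ^ 4) set"] by simp
  also have "\<dots> = (CARD('a) - 1) * (CARD('a) ^ 3 + CARD('a) ^ 2 + CARD('a) + 1)"
    by (simp add: m power2_eq_square power3_eq_cube power4_eq_xxxx algebra_simps)
  finally show ?thesis
    by (simp only: mult_cancel_left) (simp add: m)
qed

lemma card_planes_through_point:
  assumes "x \<noteq> (0::'a::{field,finite} ^ 4)"
  shows "card {H \<in> planes. x \<in> H} = CARD('a) ^ 2 + CARD('a) + 1"
proof -
  obtain m where m: "CARD('a) = m + 2" using two_le_CARD[where 'a='a] by (metis add.commute le_Suc_ex)
  have "{c. {x} \<subseteq> hyperplane c} = hyperplane x" by (auto simp: mem_hyperplane scalar_product_commute)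
  then have "(CARD('a) - 1) * card {H \<in> planes. x \<in> H} = CARD('a) ^ 3 - 1"
    using card_planes_containing[of "{x}"] card_hyperplane[OF assms] by simp
  also have "\<dots> = (CARD('a) - 1) * (CARD('a) ^ 2 + CARD('a) + 1)"
    by (simp add: m power2_eq_square power3_eq_cube algebra_simps)
  finally show ?thesis
    by (simp only: mult_cancel_left) (simp add: m)
qed

text \<open>By duality the coordinate vectors of these planes form the intersection of the
  hyperplanes of \<open>x\<close> and \<open>y\<close>, which differ because \<open>y\<close> is not
  a multiple of \<open>x\<close>.\<close>

lemma card_planes_through_two_points:
  assumes "x \<noteq> (0::'a::{field,finite} ^ 4)" "y \<notin> vec.span {x}"
  shows "card {H \<in> planes. x \<in> H \<and> y \<in> H} = CARD('a) + 1"
proof -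
  obtain m where m: "CARD('a) = m + 2" using two_le_CARD[where 'a='a] by (metis add.commute le_Suc_ex)
  have "{c. {x, y} \<subseteq> hyperplane c} = hyperplane x \<inter> hyperplane y"
    by (auto simp: mem_hyperplane scalar_product_commute)
  moreover have "\<not> hyperplane x \<subseteq> hyperplane y"
    using hyperplane_eqD[of x y] assms by (auto simp: vec.span_singleton)
  then have "card (hyperplane x \<inter> hyperplane y) = CARD('a) ^ 2"
    using card_Int_hyperplane[OF subspace_hyperplane, of x y] card_hyperplane[OF assms(1)]
    by (simp add: power2_eq_square power3_eq_cube)
  ultimately have "(CARD('a) - 1) * card {H \<in> planes. x \<in> H \<and> y \<in> H} = CARD('a) ^ 2 - 1"
    using card_planes_containing[of "{x, y}"] by simp
  also have "\<dots> = (CARD('a) - 1) * (CARD('a) + 1)"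
    by (simp add: m power2_eq_square algebra_simps)
  finally show ?thesis
    by (simp only: mult_cancel_left) (simp add: m)
qed

subsection \<open>Curve points and tangents in a plane\<close>

text \<open>Curve points are tracked by their parameters; since \<open>curve_point\<close> is
  injective, the counts are the same as those of \<open>curve_points_in\<close>.\<close>

definition curve_params :: "('a::field ^ 4) set \<Rightarrow> 'a option set" where
  "curve_params S = {t. point_vec t \<in> S}"

lemma curve_point_eq_span: "curve_point t = vec.span {point_vec t}"
  by (cases t) (simp_all add: proj_point_def)

lemma osculating_plane_eq_hyperplane: "osculating_plane t = hyperplane (osc_vec t)"
  by (cases t) (auto simp: proj_plane_def mem_hyperplane scalar_product_4)

lemma tangent_eq_span: "tangent t = vec.span {point_vec t, tangent_vec t}"
proof -
  have "tangent t = vec.span (vec.span {point_vec t} \<union> vec.span {tangent_vec t})"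
    by (cases t) (simp_all add: line_through_def proj_point_def)
  also have "\<dots> = vec.span {point_vec t, tangent_vec t}"
    by (intro subset_antisym vec.span_minimal vec.subspace_span Un_least vec.span_mono)
      (auto intro: vec.span_base)
  finally show ?thesis .
qed

lemma span_singleton_subset_iff: "vec.subspace S \<Longrightarrow> vec.span {x} \<subseteq> S \<longleftrightarrow> x \<in> S"
  using vec.span_minimal[of "{x}" S] by (auto intro: vec.span_base)

lemma span_pair_subset_iff: "vec.subspace S \<Longrightarrow> vec.span {x, y} \<subseteq> S \<longleftrightarrow> x \<in> S \<and> y \<in> S"
  using vec.span_minimal[of "{x, y}" S] by (auto intro: vec.span_base)

lemma tangent_subset_iff:
  "vec.subspace S \<Longrightarrow> tangent t \<subseteq> S \<longleftrightarrow> point_vec t \<in> S \<and> tangent_vec t \<in> S"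
  by (simp add: tangent_eq_span span_pair_subset_iff)

lemma point_in_tangent: "point_vec t \<in> tangent t"
  by (simp add: tangent_eq_span vec.span_base)

lemma point_vec_in_osculating_plane: "point_vec s \<in> osculating_plane t \<longleftrightarrow> s = t"
  by (simp add: osculating_plane_eq_hyperplane mem_hyperplane osc_vec_point_vec)

lemma subspace_osculating_plane: "vec.subspace (osculating_plane t)"
  by (simp add: osculating_plane_eq_hyperplane subspace_hyperplane)

lemma tangent_subset_osculating_plane: "tangent t \<subseteq> osculating_plane t"
  using osc_vec_tangent_vec[of t] osc_vec_point_vec[of t t]
  by (simp add: tangent_subset_iff subspace_osculating_plane)
    (simp add: osculating_plane_eq_hyperplane mem_hyperplane)

lemma osculating_plane_in_planes: "osculating_plane t \<in> (planes :: ('a::{field,finite} ^ 4) set set)"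
proof -
  have "osc_vec t \<noteq> 0" by (cases t) (auto simp: vec4_eq_iff)
  then show ?thesis by (simp add: osculating_plane_eq_hyperplane hyperplane_in_planes)
qed

lemma point_vec_nonzero: "point_vec t \<noteq> 0"
  by (cases t) (auto simp: vec4_eq_iff)

text \<open>The osculating plane at \<open>t\<close> contains the point at \<open>t\<close> and no
  other curve point, so it separates the two.\<close>

lemma point_vec_notin_span: "s \<noteq> t \<Longrightarrow> point_vec s \<notin> vec.span {point_vec t}"
  using span_singleton_subset_iff[OF subspace_osculating_plane, of "point_vec t" t]
    point_vec_in_osculating_plane by blast

lemma tangent_vec_notin_span: "tangent_vec t \<notin> vec.span {point_vec t}"
  by (cases t) (auto simp: vec4_eq_iff vec.span_singleton)

lemma tangent_in_lines: "tangent t \<in> lines"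
  by (simp add: tangent_eq_span span_pair_in_lines point_vec_nonzero tangent_vec_notin_span)

lemma curve_params_osculating_plane: "curve_params (osculating_plane t) = {t}"
  by (auto simp: curve_params_def point_vec_in_osculating_plane)

lemma curve_params_tangent: "curve_params (tangent t) = {t}"
  using tangent_subset_osculating_plane[of t] point_in_tangent[of t] point_vec_in_osculating_plane
  by (auto simp: curve_params_def)

lemma inj_tangent: "inj tangent"
  by (metis curve_params_tangent injI singleton_inject)

lemma inj_osculating_plane: "inj osculating_plane"
  by (metis curve_params_osculating_plane injI singleton_inject)

lemma inj_curve_point: "inj curve_point"
proof (rule injI)
  fix s t :: "'a option" assume "curve_point s = curve_point t"
  then have "point_vec s \<in> vec.span {point_vec t}"
    by (metis curve_point_eq_span insertI1 vec.span_base)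
  then show "s = t" using point_vec_notin_span by blast
qed

lemma curve_points_in_eq: "vec.subspace S \<Longrightarrow> curve_points_in S = curve_point ` curve_params S"
proof -
  assume "vec.subspace S"
  then have "curve_point t \<subseteq> S \<longleftrightarrow> t \<in> curve_params S" for t
    by (simp add: curve_point_eq_span span_singleton_subset_iff curve_params_def)
  then show ?thesis by (auto simp: curve_points_in_def twisted_cubic_def)
qed

lemma card_curve_points_in: "vec.subspace S \<Longrightarrow> card (curve_points_in S) = card (curve_params S)"
  by (simp add: curve_points_in_eq card_image inj_on_subset[OF inj_curve_point])

lemma subspace_lines: "l \<in> lines \<Longrightarrow> vec.subspace l"
  by (simp add: lines_def)

lemma subspace_planes: "H \<in> planes \<Longrightarrow> vec.subspace H"
  by (simp add: planes_def)

lemma dC_planes_eq: "dC_planes d = {H \<in> planes. card (curve_params H) = d}"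
  by (auto simp: dC_planes_def card_curve_points_in subspace_planes)

lemma curve_params_hyperplane: "curve_params (hyperplane c) = {t. vanishes_at c t}"
  by (simp add: curve_params_def mem_hyperplane)

lemma tangent_subset_hyperplane: "tangent t \<subseteq> hyperplane c \<longleftrightarrow> tangent_at c t"
  by (simp add: tangent_subset_iff subspace_hyperplane mem_hyperplane)

lemma card_curve_params_plane:
  assumes "H \<in> (planes :: ('a::{field,finite} ^ 4) set set)"
  shows "card (curve_params H) \<le> 3"
proof -
  obtain c where "c \<noteq> 0" "H = hyperplane c" using assms by (rule planesE)
  then show ?thesis using card_zeros_le[of c] by (simp add: curve_params_hyperplane)
qed

text \<open>The double root at \<open>t\<close> is not triple, since that would make
  \<open>H\<close> the osculating plane. Hence there is a second root, and a third one would exceed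
  the degree.\<close>

lemma plane_through_tangent:
  assumes "H \<in> (planes :: ('a::{field,finite} ^ 4) set set)" "tangent t \<subseteq> H" "H \<noteq> osculating_plane t"
  shows "card (curve_params H) = 2"
proof -
  obtain c where c: "c \<noteq> 0" "H = hyperplane c" using assms(1) by (rule planesE)
  have t: "tangent_at c t" using assms c by (simp add: tangent_subset_hyperplane)
  then obtain u where u: "u \<noteq> t" "vanishes_at c u"
  proof (rule tangent_cases[OF _ c(1)])
    fix k assume "c = k *s osc_vec t"
    with c assms(3) show thesis
      by (auto simp: osculating_plane_eq_hyperplane hyperplane_def scalar_product_left)
  qed
  have "v = t \<or> v = u" if "vanishes_at c v" for v
    using tangent_and_two_points[OF t u(2) that] c u by blast
  then have "curve_params H = {t, u}" using t u c by (auto simp: curve_params_hyperplane)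
  with u show ?thesis by simp
qed

text \<open>A cubic with exactly two distinct roots repeats one of them, and it cannot repeat
  both.\<close>

lemma two_point_plane_tangent:
  assumes "H \<in> (dC_planes 2 :: ('a::{field,finite} ^ 4) set set)"
  shows "\<exists>!t. tangent t \<subseteq> H"
proof -
  have H: "H \<in> planes" "card (curve_params H) = 2" using assms by (auto simp: dC_planes_eq)
  obtain c where c: "c \<noteq> 0" "H = hyperplane c" using H(1) by (rule planesE)
  obtain t u where tu: "curve_params H = {t, u}" "u \<noteq> t" using H by (metis card_2_iff)
  then have v: "vanishes_at c v \<longleftrightarrow> v = t \<or> v = u" for v
    using c curve_params_hyperplane[of c] by blast
  then have "tangent_at c t \<or> tangent_at c u"
    using two_zeros_cases[of c t u] tu c by metis
  then have "\<exists>t. tangent t \<subseteq> H" using c tangent_subset_hyperplane by blast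
  moreover have "s = r" if "tangent s \<subseteq> H" "tangent r \<subseteq> H" for r s
    using two_tangents[of c s r] that c tangent_subset_hyperplane by blast
  ultimately show ?thesis by blast
qed

text \<open>The line lies in the plane spanned by the tangent at \<open>t\<close> and the point at \<open>u\<close>, which contains no third point of the curve.\<close>

lemma curve_params_line:
  fixes l :: "('a::{field,finite} ^ 4) set"
  assumes "l \<in> lines" "t \<in> curve_params l" "u \<in> curve_params l" "t \<noteq> u"
  shows "l = vec.span {point_vec t, point_vec u}" "curve_params l = {t, u}"
proof -
  show l: "l = vec.span {point_vec t, point_vec u}"
    using assms by (intro line_eq_span_pair)
      (auto simp: curve_params_def point_vec_nonzero point_vec_notin_span)
  obtain c where c: "c \<noteq> 0" "{point_vec t, tangent_vec t, point_vec u} \<subseteq> hyperplane c"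
    by (rule ex_hyperplane_containing[of "{point_vec t, tangent_vec t, point_vec u}"])
      (simp add: card_insert_if)
  then have "tangent_at c t" "vanishes_at c u" "l \<subseteq> hyperplane c"
    by (auto simp: mem_hyperplane l span_pair_subset_iff subspace_hyperplane)
  then have "v = t \<or> v = u" if "v \<in> curve_params l" for v
  proof -
    have "vanishes_at c v"
      using that \<open>l \<subseteq> hyperplane c\<close> by (auto simp: curve_params_def mem_hyperplane)
    then show ?thesis
      using tangent_and_two_points[of c t u v] \<open>tangent_at c t\<close> \<open>vanishes_at c u\<close> assms(4) c(1)
      by metis
  qed
  then show "curve_params l = {t, u}" using assms by blast
qed

subsection \<open>Counting unisecants\<close>

lemma unisecants_iff: "l \<in> unisecants \<longleftrightarrow> l \<in> lines \<and> (\<exists>t. curve_params l = {t})"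
proof -
  have "card (curve_points_in l) = 1 \<longleftrightarrow> (\<exists>t. curve_params l = {t})" if "l \<in> lines"
    using that by (simp add: card_curve_points_in subspace_lines card_1_singleton_iff)
  then show ?thesis by (auto simp: unisecants_def)
qed

lemma external_lines_iff: "l \<in> external_lines \<longleftrightarrow> l \<in> lines \<and> curve_params l = {}"
  by (auto simp: external_lines_def curve_points_in_eq subspace_lines)

lemma tangent_in_unisecants: "tangent t \<in> unisecants"
  by (simp add: unisecants_iff tangent_in_lines curve_params_tangent)

lemma curve_params_mono: "S \<subseteq> T \<Longrightarrow> curve_params S \<subseteq> curve_params T"
  by (auto simp: curve_params_def)

lemma curve_params_Int: "curve_params (S \<inter> T) = curve_params S \<inter> curve_params T"
  by (auto simp: curve_params_def)

text \<open>An osculating plane meets the curve only in its own point, so a Gamma-plane through the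
  line can only be the one at the curve point of the line. Conversely, lying in that plane makes the
  line a unisecant, and only the tangent at the same parameter has to be excluded.\<close>

lemma UGamma_lines_iff:
  "l \<in> UGamma_lines \<longleftrightarrow> l \<in> lines \<and> (\<exists>t. t \<in> curve_params l \<and> l \<subseteq> osculating_plane t \<and> l \<noteq> tangent t)"
  (is "_ \<longleftrightarrow> ?R")
proof
  assume l: "l \<in> UGamma_lines"
  then obtain s t where "curve_params l = {s}" "l \<subseteq> osculating_plane t"
    by (auto simp: UGamma_lines_def unisecants_iff Gamma_planes_def)
  moreover have "s = t"
    using calculation curve_params_mono[of l "osculating_plane t"]
    by (simp add: curve_params_osculating_plane)
  ultimately show ?R using l by (auto simp: UGamma_lines_def unisecants_def T_lines_def)
next
  assume ?R
  then obtain t where l: "l \<in> lines" "t \<in> curve_params l" "l \<subseteq> osculating_plane t" "l \<noteq> tangent t"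
    by blast
  then have "curve_params l = {t}"
    using curve_params_mono[OF l(3)] by (auto simp: curve_params_osculating_plane)
  moreover have "l \<noteq> tangent s" for s
    using calculation l(4) curve_params_tangent[of s] by auto
  ultimately show "l \<in> UGamma_lines"
    using l by (auto simp: UGamma_lines_def unisecants_iff Gamma_planes_def T_lines_def)
qed

lemma unisecants_partition:
  "unisecants = T_lines \<union> UGamma_lines \<union> UnGamma_lines"
  "T_lines \<inter> UGamma_lines = {}" "(T_lines \<union> UGamma_lines) \<inter> UnGamma_lines = {}"
proof -
  show "T_lines \<inter> UGamma_lines = {}" by (auto simp: UGamma_lines_def)
  have T: "\<exists>G\<in>Gamma_planes. l \<subseteq> G" if "l \<in> T_lines" for l
    using that tangent_subset_osculating_plane by (auto simp: T_lines_def Gamma_planes_def)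
  then show "(T_lines \<union> UGamma_lines) \<inter> UnGamma_lines = {}"
    by (auto simp: UGamma_lines_def UnGamma_lines_def)
  show "unisecants = T_lines \<union> UGamma_lines \<union> UnGamma_lines"
    using tangent_in_unisecants by (auto simp: T_lines_def UGamma_lines_def UnGamma_lines_def)
qed

section \<open>Lines cut out of a plane by the osculating planes\<close>

lemma card_T_lines_in: "card {l \<in> T_lines. l \<subseteq> H} = card {t. tangent t \<subseteq> H}"
proof -
  have "{l \<in> T_lines. l \<subseteq> H} = tangent ` {t. tangent t \<subseteq> H}" by (auto simp: T_lines_def)
  then show ?thesis by (simp add: card_image inj_on_subset[OF inj_tangent])
qed

lemma plane_Int_osculating_plane:
  fixes H :: "('a::{field,finite} ^ 4) set"
  assumes "H \<in> planes" "H \<noteq> osculating_plane t"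
  shows "H \<inter> osculating_plane t \<in> lines"
    and "tangent t \<subseteq> H \<longleftrightarrow> H \<inter> osculating_plane t = tangent t"
    and "curve_params (H \<inter> osculating_plane t) = curve_params H \<inter> {t}"
proof -
  show *: "H \<inter> osculating_plane t \<in> lines"
    using assms by (intro Int_planes osculating_plane_in_planes)
  show "tangent t \<subseteq> H \<longleftrightarrow> H \<inter> osculating_plane t = tangent t"
    using lines_subset_eq[OF tangent_in_lines *] tangent_subset_osculating_plane by blast
  show "curve_params (H \<inter> osculating_plane t) = curve_params H \<inter> {t}"
    by (simp add: curve_params_Int curve_params_osculating_plane)
qed

text \<open>The UGamma-lines of \<open>H\<close> are the intersections of \<open>H\<close> with the
  osculating planes at those of its curve points whose tangent is not in \<open>H\<close>. They are
  distinct, as each contains only its own curve point.\<close>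

lemma card_UGamma_lines_in_plane:
  fixes H :: "('a::{field,finite} ^ 4) set"
  assumes H: "H \<in> planes" "H \<notin> Gamma_planes"
  shows "card {l \<in> UGamma_lines. l \<subseteq> H} = card (curve_params H) - card {t. tangent t \<subseteq> H}"
proof -
  let ?D = "curve_params H - {t. tangent t \<subseteq> H}"
  have ne: "H \<noteq> osculating_plane t" for t using H by (auto simp: Gamma_planes_def)
  note Int = plane_Int_osculating_plane[OF H(1) ne]
  have "{l \<in> UGamma_lines. l \<subseteq> H} = (\<lambda>t. H \<inter> osculating_plane t) ` ?D"
  proof (intro set_eqI iffI)
    fix l assume "l \<in> {l \<in> UGamma_lines. l \<subseteq> H}"
    then obtain t where l: "l \<in> lines" "t \<in> curve_params l" "l \<subseteq> osculating_plane t" "l \<noteq> tangent t" "l \<subseteq> H"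
      by (auto simp: UGamma_lines_iff)
    then have "l = H \<inter> osculating_plane t" using lines_subset_eq[OF l(1) Int(1)] by auto
    moreover have "t \<in> ?D" using l Int(2)[of t] calculation curve_params_mono[OF l(5)] by auto
    ultimately show "l \<in> (\<lambda>t. H \<inter> osculating_plane t) ` ?D" by blast
  next
    fix l assume "l \<in> (\<lambda>t. H \<inter> osculating_plane t) ` ?D"
    then obtain t where t: "t \<in> ?D" "l = H \<inter> osculating_plane t" by blast
    then have "t \<in> curve_params l" "l \<noteq> tangent t" using Int(2,3)[of t] by auto
    then show "l \<in> {l \<in> UGamma_lines. l \<subseteq> H}" using t Int(1)[of t] by (auto simp: UGamma_lines_iff)
  qed
  moreover have "inj_on (\<lambda>t. H \<inter> osculating_plane t) ?D"
  proof (rule inj_onI)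
    fix s t assume "s \<in> ?D" "t \<in> ?D" "H \<inter> osculating_plane s = H \<inter> osculating_plane t"
    then have "curve_params H \<inter> {s} = curve_params H \<inter> {t}" using Int(3) by metis
    with \<open>s \<in> ?D\<close> \<open>t \<in> ?D\<close> show "s = t" by auto
  qed
  \<comment> \<open>This inclusion makes the truncated subtraction an honest one.\<close>
  moreover have "{t. tangent t \<subseteq> H} \<subseteq> curve_params H"
    using point_in_tangent by (auto simp: curve_params_def)
  ultimately show ?thesis by (simp add: card_image card_Diff_subset)
qed

lemma card_unisecants_sum:
  assumes "L \<subseteq> (unisecants :: ('a::{field,finite} ^ 4) set set)"
  shows "card L = (\<Sum>t\<in>UNIV. card {l \<in> L. t \<in> curve_params l})"
proof -
  have "\<forall>l\<in>L. card {t \<in> UNIV. t \<in> curve_params l} = 1"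
  proof
    fix l assume "l \<in> L"
    then have "l \<in> unisecants" using assms by blast
    then obtain t where "curve_params l = {t}" by (auto simp: unisecants_iff)
    then show "card {t \<in> UNIV. t \<in> curve_params l} = 1" by simp
  qed
  then show ?thesis by (simp add: sum_multicount[of UNIV L "\<lambda>t l. t \<in> curve_params l" 1])
qed

text \<open>A line of \<open>S\<close> through the curve point at \<open>t\<close> is either a
  unisecant or the chord to exactly one other curve point of \<open>S\<close>.\<close>

lemma card_unisecants_at:
  fixes S :: "('a::{field,finite} ^ 4) set"
  assumes S: "vec.subspace S" "t \<in> curve_params S"
  shows "card {l \<in> unisecants. l \<subseteq> S \<and> t \<in> curve_params l} + (card (curve_params S) - 1)
    = card {l \<in> lines. point_vec t \<in> l \<and> l \<subseteq> S}"
proof -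
  let ?U = "{l \<in> unisecants. l \<subseteq> S \<and> t \<in> curve_params l}"
  let ?C = "(\<lambda>u. vec.span {point_vec t, point_vec u}) ` (curve_params S - {t})"
  have chord: "vec.span {point_vec t, point_vec u} \<in> lines \<and> curve_params (vec.span {point_vec t, point_vec u}) = {t, u}"
    if "u \<noteq> t" for u
  proof -
    have l: "vec.span {point_vec t, point_vec u} \<in> lines"
      using that by (simp add: span_pair_in_lines point_vec_nonzero point_vec_notin_span)
    then show ?thesis using curve_params_line(2)[OF l, of t u] that
      by (auto simp: curve_params_def vec.span_base)
  qed
  have "{l \<in> lines. point_vec t \<in> l \<and> l \<subseteq> S} = ?U \<union> ?C"
  proof (intro set_eqI iffI)
    fix l assume l: "l \<in> {l \<in> lines. point_vec t \<in> l \<and> l \<subseteq> S}"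
    then have t: "t \<in> curve_params l" by (simp add: curve_params_def)
    show "l \<in> ?U \<union> ?C"
    proof (cases "curve_params l = {t}")
      case True
      with l show ?thesis by (auto simp: unisecants_iff)
    next
      case False
      with t obtain u where u: "u \<in> curve_params l" "u \<noteq> t" by blast
      then have "l = vec.span {point_vec t, point_vec u}" using curve_params_line(1)[of l t u] l t by auto
      moreover have "u \<in> curve_params S" using u l curve_params_mono[of l S] by auto
      ultimately show ?thesis using u by blast
    qed
  next
    fix l assume "l \<in> ?U \<union> ?C"
    then show "l \<in> {l \<in> lines. point_vec t \<in> l \<and> l \<subseteq> S}"
    proof
      assume "l \<in> ?U"
      then show ?thesis by (auto simp: unisecants_iff curve_params_def)
    next
      assume "l \<in> ?C"
      then obtain u where u: "u \<in> curve_params S" "u \<noteq> t" "l = vec.span {point_vec t, point_vec u}" by blast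
      then have "l \<subseteq> S" using S by (simp add: span_pair_subset_iff curve_params_def)
      then show ?thesis using u chord[of u] by (auto simp: vec.span_base)
    qed
  qed
  moreover have "?U \<inter> ?C = {}"
  proof (rule equals0I)
    fix l assume l: "l \<in> ?U \<inter> ?C"
    then obtain u where "u \<noteq> t" "l = vec.span {point_vec t, point_vec u}" by blast
    then have "curve_params l = {t, u}" "u \<noteq> t" using chord[of u] by simp_all
    moreover obtain s where "curve_params l = {s}" using l by (auto simp: unisecants_iff)
    ultimately show False by auto
  qed
  moreover have "inj_on (\<lambda>u. vec.span {point_vec t, point_vec u}) (curve_params S - {t})"
  proof (rule inj_onI)
    fix u v assume "u \<in> curve_params S - {t}" "v \<in> curve_params S - {t}"
      "vec.span {point_vec t, point_vec u} = vec.span {point_vec t, point_vec v}"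
    then have "{t, u} = {t, v}" "u \<noteq> t" "v \<noteq> t" using chord[of u] chord[of v] by auto
    then show "u = v" by auto
  qed
  then have "card ?C = card (curve_params S) - 1" using S by (simp add: card_image)
  ultimately show ?thesis by (simp add: card_Un_disjoint)
qed

lemma CARD_option: "CARD('a::finite option) = CARD('a) + 1"
  by (simp add: card_UNIV_option)

text \<open>Of the q^2 + q + 1 lines through a curve point, q are chords to the remaining curve
  points.\<close>

lemma card_unisecants: "card (unisecants :: ('a::{field,finite} ^ 4) set set) = (CARD('a) + 1) * (CARD('a) ^ 2 + 1)"
proof -
  have "card {l \<in> unisecants. t \<in> curve_params l} = CARD('a) ^ 2 + 1" for t :: "'a option"
  proof -
    have "curve_params (UNIV :: ('a ^ 4) set) = UNIV" by (simp add: curve_params_def)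
    then show ?thesis
      using card_unisecants_at[OF vec.subspace_UNIV, of t] card_lines_through_point[OF point_vec_nonzero, of t]
      by (simp add: CARD_option)
  qed
  then show ?thesis by (simp add: card_unisecants_sum[OF subset_refl] CARD_option)
qed

text \<open>If \<open>H\<close> has d curve points, each of them is on q + 1 lines of
  \<open>H\<close>, of which d - 1 are chords.\<close>

lemma card_unisecants_in_plane:
  fixes H :: "('a::{field,finite} ^ 4) set"
  assumes H: "H \<in> planes"
  shows "card {l \<in> unisecants. l \<subseteq> H}
    = card (curve_params H) * (CARD('a) + 1 - (card (curve_params H) - 1))"
proof -
  let ?L = "{l \<in> unisecants. l \<subseteq> H}"
  have "card {l \<in> ?L. t \<in> curve_params l}
      = (if t \<in> curve_params H then CARD('a) + 1 - (card (curve_params H) - 1) else 0)" for t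
  proof (cases "t \<in> curve_params H")
    case True
    have "{l \<in> ?L. t \<in> curve_params l} = {l \<in> unisecants. l \<subseteq> H \<and> t \<in> curve_params l}" by auto
    then show ?thesis
      using True card_unisecants_at[OF subspace_planes[OF H] True]
        card_lines_through_in_plane[OF H, of "point_vec t"]
      by (simp add: curve_params_def point_vec_nonzero)
  next
    case False
    then have "{l \<in> ?L. t \<in> curve_params l} = {}" by (auto simp: curve_params_def)
    with False show ?thesis by simp
  qed
  then show ?thesis by (simp add: card_unisecants_sum[of ?L] sum.If_cases)
qed

lemma card_T_lines: "card (T_lines :: ('a::{field,finite} ^ 4) set set) = CARD('a) + 1"
  unfolding T_lines_def by (simp add: card_image inj_tangent CARD_option)

text \<open>At each of the q + 1 parameters, the q + 1 lines of the osculating plane through its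
  curve point, without the tangent.\<close>

lemma card_UGamma_lines: "card (UGamma_lines :: ('a::{field,finite} ^ 4) set set) = (CARD('a) + 1) * CARD('a)"
proof -
  have "card {l \<in> UGamma_lines. t \<in> curve_params l} = CARD('a)" for t :: "'a option"
  proof -
    let ?L = "{l \<in> lines. point_vec t \<in> l \<and> l \<subseteq> osculating_plane t}"
    have "{l \<in> UGamma_lines. t \<in> curve_params l} = ?L - {tangent t}"
    proof (intro set_eqI iffI)
      fix l assume l: "l \<in> {l \<in> UGamma_lines. t \<in> curve_params l}"
      then obtain s where "s \<in> curve_params l" "l \<subseteq> osculating_plane s" "l \<noteq> tangent s" "l \<in> lines"
        by (auto simp: UGamma_lines_iff)
      moreover have "s = t"
        using l calculation curve_params_mono[of l "osculating_plane s"] by (auto simp: curve_params_osculating_plane)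
      ultimately show "l \<in> ?L - {tangent t}" by (auto simp: curve_params_def)
    next
      fix l assume "l \<in> ?L - {tangent t}"
      then show "l \<in> {l \<in> UGamma_lines. t \<in> curve_params l}"
        by (auto simp: UGamma_lines_iff curve_params_def)
    qed
    moreover have "tangent t \<in> ?L"
      by (simp add: tangent_in_lines point_in_tangent tangent_subset_osculating_plane)
    moreover have "card ?L = CARD('a) + 1"
      by (intro card_lines_through_in_plane osculating_plane_in_planes point_vec_nonzero)
        (simp add: point_vec_in_osculating_plane)
    ultimately show ?thesis by (simp add: card_Diff_subset)
  qed
  moreover have "UGamma_lines \<subseteq> (unisecants :: ('a ^ 4) set set)" by (auto simp: UGamma_lines_def)
  ultimately show ?thesis by (simp add: card_unisecants_sum CARD_option)
qed

lemma card_unisecants_split: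
  fixes H :: "('a::{field,finite} ^ 4) set"
  shows "card {l \<in> unisecants. l \<subseteq> H}
    = card {l \<in> T_lines. l \<subseteq> H} + card {l \<in> UGamma_lines. l \<subseteq> H} + card {l \<in> UnGamma_lines. l \<subseteq> H}"
proof -
  have "{l \<in> unisecants. l \<subseteq> H}
      = ({l \<in> T_lines. l \<subseteq> H} \<union> {l \<in> UGamma_lines. l \<subseteq> H}) \<union> {l \<in> UnGamma_lines. l \<subseteq> H}"
    using unisecants_partition(1) by auto
  also have "card \<dots> = card ({l \<in> T_lines. l \<subseteq> H} \<union> {l \<in> UGamma_lines. l \<subseteq> H}) + card {l \<in> UnGamma_lines. l \<subseteq> H}"
    using unisecants_partition(3) by (intro card_Un_disjoint) auto
  also have "card ({l \<in> T_lines. l \<subseteq> H} \<union> {l \<in> UGamma_lines. l \<subseteq> H})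
      = card {l \<in> T_lines. l \<subseteq> H} + card {l \<in> UGamma_lines. l \<subseteq> H}"
    using unisecants_partition(2) by (intro card_Un_disjoint) auto
  finally show ?thesis .
qed

lemma card_UnGamma_lines:
  "card (UnGamma_lines :: ('a::{field,finite} ^ 4) set set) = (CARD('a) + 1) * (CARD('a) ^ 2 - CARD('a))"
proof -
  have "(CARD('a) + 1) * (CARD('a) ^ 2 + 1)
      = (CARD('a) + 1) + (CARD('a) + 1) * CARD('a) + card (UnGamma_lines :: ('a ^ 4) set set)"
    \<comment> \<open>Taking the whole space for \<open>H\<close> splits the set of all
      unisecants.\<close>
    using card_unisecants_split[of "UNIV :: ('a ^ 4) set"]
    by (simp only: subset_UNIV simp_thms Collect_mem_eq card_unisecants card_T_lines card_UGamma_lines)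
  then show ?thesis by (simp add: algebra_simps power2_eq_square power3_eq_cube diff_mult_distrib2)
qed

subsection \<open>Counting planes by type\<close>

lemma dC_planes_not_Gamma: "d \<noteq> 1 \<Longrightarrow> H \<in> dC_planes d \<Longrightarrow> H \<notin> Gamma_planes"
  by (auto simp: dC_planes_eq Gamma_planes_def curve_params_osculating_plane)

lemma bar1C_planes_eq: "bar1C_planes = {H \<in> dC_planes 1. H \<notin> Gamma_planes}"
  by (auto simp: bar1C_planes_def dC_planes_def)

lemma card_tangents_in_two_point_plane:
  assumes "H \<in> (dC_planes 2 :: ('a::{field,finite} ^ 4) set set)"
  shows "card {t. tangent t \<subseteq> H} = 1"
proof -
  obtain t where "{t. tangent t \<subseteq> H} = {t}" using two_point_plane_tangent[OF assms] by blast
  then show ?thesis by simp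
qed

lemma no_tangent_in_plane:
  assumes "H \<in> dC_planes 3 \<union> bar1C_planes \<union> (dC_planes 0 :: ('a::{field,finite} ^ 4) set set)"
  shows "\<not> tangent t \<subseteq> H"
proof
  assume t: "tangent t \<subseteq> H"
  have "H \<in> planes" "H \<notin> Gamma_planes" "card (curve_params H) \<noteq> 2"
    using assms dC_planes_not_Gamma[of 3 H] dC_planes_not_Gamma[of 0 H]
    by (auto simp: bar1C_planes_eq dC_planes_eq)
  with plane_through_tangent[OF _ t] show False by (auto simp: Gamma_planes_def)
qed

text \<open>Of the q + 1 planes through the tangent, only the osculating plane is not a
  2_C-plane.\<close>

lemma card_two_point_planes_through_tangent:
  "card {H \<in> (dC_planes 2 :: ('a::{field,finite} ^ 4) set set). tangent t \<subseteq> H} = CARD('a)"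
proof -
  have "{H \<in> planes. tangent t \<subseteq> H} = insert (osculating_plane t) {H \<in> dC_planes 2. tangent t \<subseteq> H}"
    using plane_through_tangent[of _ t] osculating_plane_in_planes[of t] tangent_subset_osculating_plane[of t]
    by (auto simp: dC_planes_eq)
  moreover have "osculating_plane t \<notin> {H \<in> dC_planes 2. tangent t \<subseteq> H}"
    by (simp add: dC_planes_eq curve_params_osculating_plane)
  moreover have "{H \<in> planes. tangent t \<subseteq> H} = {H \<in> planes. point_vec t \<in> H \<and> tangent_vec t \<in> H}"
    using tangent_subset_iff subspace_planes by blast
  then have "card {H \<in> planes. tangent t \<subseteq> H} = CARD('a) + 1"
    using card_planes_through_two_points[OF point_vec_nonzero tangent_vec_notin_span, of t] by simp
  ultimately show ?thesis by simp
qed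

lemma card_dC_planes_2: "card (dC_planes 2 :: ('a::{field,finite} ^ 4) set set) = (CARD('a) + 1) * CARD('a)"
proof -
  have "(\<Sum>t\<in>UNIV. card {H \<in> (dC_planes 2 :: ('a ^ 4) set set). tangent t \<subseteq> H}) = 1 * card (dC_planes 2 :: ('a ^ 4) set set)"
    using card_tangents_in_two_point_plane by (intro sum_multicount) auto
  then show ?thesis by (simp add: card_two_point_planes_through_tangent CARD_option)
qed

lemma sum_planes_by_type:
  fixes f :: "nat \<Rightarrow> nat"
  shows "(\<Sum>H\<in>(planes :: ('a::{field,finite} ^ 4) set set). f (card (curve_params H)))
    = (\<Sum>d\<in>{0, 1, 2, 3}. f d * card (dC_planes d :: ('a ^ 4) set set))"
proof -
  let ?P = "planes :: ('a ^ 4) set set"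
  have le_3: "n \<in> {0, 1, 2, 3}" if "n \<le> 3" for n :: nat using that by auto
  have types: "(\<lambda>H. card (curve_params H)) ` ?P \<subseteq> {0, 1, 2, 3}"
  proof (rule image_subsetI)
    fix H :: "('a ^ 4) set" assume "H \<in> planes"
    then show "card (curve_params H) \<in> {0, 1, 2, 3}" by (rule le_3[OF card_curve_params_plane])
  qed
  have "(\<Sum>H\<in>?P. f (card (curve_params H)))
      = (\<Sum>d\<in>{0, 1, 2, 3}. \<Sum>H | H \<in> ?P \<and> card (curve_params H) = d. f (card (curve_params H)))"
    by (intro sum.group[symmetric] types) simp_all
  also have "\<dots> = (\<Sum>d\<in>{0, 1, 2, 3}. f d * card (dC_planes d :: ('a ^ 4) set set))"
    by (intro sum.cong) (simp_all add: dC_planes_eq)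
  finally show ?thesis .
qed

lemma sum_card_curve_params:
  "(\<Sum>H\<in>(planes :: ('a::{field,finite} ^ 4) set set). card (curve_params H))
    = (CARD('a) + 1) * (CARD('a) ^ 2 + CARD('a) + 1)"
proof -
  have "(\<Sum>H\<in>(planes :: ('a ^ 4) set set). card {t \<in> UNIV. point_vec t \<in> H})
      = (CARD('a) ^ 2 + CARD('a) + 1) * CARD('a option)"
    using card_planes_through_point[OF point_vec_nonzero] by (intro sum_multicount) auto
  then show ?thesis by (simp add: curve_params_def CARD_option mult.commute)
qed

text \<open>The square counts ordered pairs of curve points in the plane. A pair of equal points
  lies in q^2 + q + 1 planes, a pair of distinct points in q + 1.\<close>

lemma sum_card_curve_params_square:
  "(\<Sum>H\<in>(planes :: ('a::{field,finite} ^ 4) set set). card (curve_params H) ^ 2)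
    = (CARD('a) + 1) * (CARD('a) ^ 2 + CARD('a) + 1) + (CARD('a) + 1) * CARD('a) * (CARD('a) + 1)"
proof -
  let ?P = "planes :: ('a ^ 4) set set"
  let ?k = "\<lambda>(t::'a option, u). if t = u then CARD('a) ^ 2 + CARD('a) + 1 else CARD('a) + 1"
  have "card {H \<in> ?P. point_vec t \<in> H \<and> point_vec u \<in> H} = ?k (t, u)" for t u
    using card_planes_through_point[OF point_vec_nonzero, of t]
      card_planes_through_two_points[OF point_vec_nonzero point_vec_notin_span, of u t]
    by (auto simp: eq_commute)
  then have total: "(\<Sum>H\<in>?P. card {(t, u) \<in> UNIV. point_vec t \<in> H \<and> point_vec u \<in> H}) = sum ?k UNIV"
    using sum_multicount_gen[of ?P UNIV "\<lambda>H (t, u). point_vec t \<in> H \<and> point_vec u \<in> H" ?k]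
    by (simp add: case_prod_beta')
  have square: "card {(t, u) \<in> UNIV. point_vec t \<in> H \<and> point_vec u \<in> H} = card (curve_params H) ^ 2" for H
  proof -
    have "{(t, u) \<in> UNIV. point_vec t \<in> H \<and> point_vec u \<in> H} = curve_params H \<times> curve_params H"
      by (auto simp: curve_params_def)
    then show ?thesis by (simp add: card_cartesian_product power2_eq_square)
  qed
  have iterated: "sum ?k UNIV = (\<Sum>t\<in>UNIV. \<Sum>u\<in>UNIV. ?k (t, u))"
    by (simp add: UNIV_Times_UNIV[symmetric] sum.cartesian_product del: UNIV_Times_UNIV)
  have inner: "(\<Sum>u\<in>UNIV. ?k (t, u)) = CARD('a) ^ 2 + CARD('a) + 1 + CARD('a) * (CARD('a) + 1)" for t
  proof -
    have "(\<Sum>u\<in>UNIV. ?k (t, u)) = ?k (t, t) + (\<Sum>u\<in>UNIV - {t}. ?k (t, u))"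
      by (simp add: sum.remove[of UNIV t])
    also have "(\<Sum>u\<in>UNIV - {t}. ?k (t, u)) = (\<Sum>u\<in>UNIV - {t}. CARD('a) + 1)"
      by (intro sum.cong) auto
    finally show ?thesis by (simp add: CARD_option)
  qed
  show ?thesis
    using total unfolding square iterated inner by (simp add: CARD_option algebra_simps)
qed

lemma card_Gamma_planes: "card (Gamma_planes :: ('a::{field,finite} ^ 4) set set) = CARD('a) + 1"
  unfolding Gamma_planes_def by (simp add: card_image inj_osculating_plane CARD_option)

lemma plane_type_counts:
  defines "q \<equiv> real CARD('a::{field,finite})"
  shows "real (card (dC_planes 2 :: ('a ^ 4) set set)) = (q + 1) * q"
    and "real (card (dC_planes 3 :: ('a ^ 4) set set)) = (q + 1) * q * (q - 1) / 6"
    and "real (card (bar1C_planes :: ('a ^ 4) set set)) = (q + 1) * q * (q - 1) / 2"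
    and "real (card (dC_planes 0 :: ('a ^ 4) set set)) = (q + 1) * q * (q - 1) / 3"
proof -
  define N where "N d = real (card (dC_planes d :: ('a ^ 4) set set))" for d
  have sums: "real (\<Sum>H\<in>(planes :: ('a ^ 4) set set). f (card (curve_params H)))
      = real (f 0) * N 0 + real (f 1) * N 1 + real (f 2) * N 2 + real (f 3) * N 3" for f
    unfolding sum_planes_by_type N_def by simp
  have 0: "N 0 + N 1 + N 2 + N 3 = q ^ 3 + q ^ 2 + q + 1"
    using sums[of "\<lambda>_. 1"] by (simp add: card_planes q_def)
  have 1: "N 1 + 2 * N 2 + 3 * N 3 = (q + 1) * (q ^ 2 + q + 1)"
    using sums[of "\<lambda>d. d"] unfolding sum_card_curve_params by (simp add: q_def algebra_simps)
  have 2: "N 1 + 4 * N 2 + 9 * N 3 = (q + 1) * (q ^ 2 + q + 1) + (q + 1) * q * (q + 1)"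
    using sums[of "\<lambda>d. d ^ 2"] unfolding sum_card_curve_params_square by (simp add: q_def algebra_simps)
  have N2: "N 2 = (q + 1) * q" by (simp add: N_def card_dC_planes_2 q_def algebra_simps)
  \<comment> \<open>The second moment minus the first is 2 N_2 + 6 N_3 = q (q + 1)^2, and N_2 is
    known.\<close>
  then have N3: "N 3 = (q + 1) * q * (q - 1) / 6"
    using 1 2 by (simp add: algebra_simps)
  have N1: "N 1 = (q + 1) * q * (q - 1) / 2 + (q + 1)"
    using 1 N2 N3 by (simp add: field_simps power2_eq_square)
  have N0: "N 0 = (q + 1) * q * (q - 1) / 3"
    using 0 N1 N2 N3 by (simp add: field_simps power2_eq_square power3_eq_cube)
  \<comment> \<open>Osculating planes also have exactly one curve point, so q + 1 planes must be
    removed from N_1.\<close>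
  have "Gamma_planes \<subseteq> (dC_planes 1 :: ('a ^ 4) set set)"
    by (auto simp: Gamma_planes_def dC_planes_eq osculating_plane_in_planes curve_params_osculating_plane)
  moreover have "bar1C_planes = dC_planes 1 - (Gamma_planes :: ('a ^ 4) set set)"
    by (auto simp: bar1C_planes_eq)
  ultimately have "card (bar1C_planes :: ('a ^ 4) set set) + (CARD('a) + 1) = card (dC_planes 1 :: ('a ^ 4) set set)"
    using card_Diff_subset[of "Gamma_planes :: ('a ^ 4) set set" "dC_planes 1"]
      card_mono[of "dC_planes 1" "Gamma_planes :: ('a ^ 4) set set"]
    by (simp add: card_Gamma_planes)
  then have "real (card (bar1C_planes :: ('a ^ 4) set set)) = N 1 - (q + 1)"
    unfolding N_def q_def by linarith
  then show "real (card (bar1C_planes :: ('a ^ 4) set set)) = (q + 1) * q * (q - 1) / 2"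
    using N1 by simp
  show "real (card (dC_planes 2 :: ('a ^ 4) set set)) = (q + 1) * q"
    "real (card (dC_planes 3 :: ('a ^ 4) set set)) = (q + 1) * q * (q - 1) / 6"
    "real (card (dC_planes 0 :: ('a ^ 4) set set)) = (q + 1) * q * (q - 1) / 3"
    using N2 N3 N0 by (simp_all add: N_def)
qed

lemma avg_Pi_eq:
  fixes P L :: "('a::{field,finite} ^ 4) set set"
  assumes "has_Lambda TYPE('a) L P n"
  shows "avg_Pi TYPE('a) P L = real n * real (card P) / real (card L)"
proof -
  have "(\<Sum>l\<in>L. card {H \<in> P. l \<subseteq> H}) = n * card P"
    using assms by (intro sum_multicount) (auto simp: has_Lambda_def)
  then show ?thesis by (simp add: avg_Pi_def flip: of_nat_sum of_nat_mult)
qed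

subsection \<open>Real axes and external lines in osculating planes\<close>

text \<open>The tangent has q^2 vectors and a hyperplane keeps at least q of them, so a line always
  meets a plane.\<close>

lemma ex_nonzero_tangent_Int_hyperplane:
  obtains x :: "'a::{field,finite} ^ 4" where "x \<noteq> 0" "x \<in> tangent s" "x \<in> hyperplane c"
proof -
  have l: "vec.subspace (tangent s)" "card (tangent s) = CARD('a) ^ 2"
    using tangent_in_lines[of s] by (simp_all add: lines_iff)
  have "card (tangent s) \<le> CARD('a) * card (tangent s \<inter> hyperplane c)"
  proof (cases "tangent s \<subseteq> hyperplane c")
    case True
    then show ?thesis by (simp add: Int_absorb2)
  next
    case False
    then show ?thesis using card_Int_hyperplane[OF l(1)] by (intro eq_imp_le)
  qed
  then have "2 \<le> card (tangent s \<inter> hyperplane c)"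
    using l two_le_CARD[where 'a='a] by (simp add: power2_eq_square)
  then have "\<not> tangent s \<inter> hyperplane c \<subseteq> {0}"
    using card_mono[of "{0}" "tangent s \<inter> hyperplane c"] by auto
  then show thesis using that by blast
qed

lemma tangent_Int_osculating_planes:
  assumes three: "(3::'a::{field,finite}) \<noteq> 0" and "distinct [s, a, b]"
    and x: "x \<in> tangent s" "x \<in> osculating_plane a" "x \<in> osculating_plane (b :: 'a option)"
  shows "x = 0"
proof -
  obtain \<alpha> where "x - \<alpha> *s point_vec s \<in> vec.span {tangent_vec s}"
    using x(1) unfolding tangent_eq_span vec.span_insert[of "point_vec s"] by blast
  then obtain \<beta> where "x - \<alpha> *s point_vec s = \<beta> *s tangent_vec s"
    by (auto simp: vec.span_singleton)
  then have "x = \<alpha> *s point_vec s + \<beta> *s tangent_vec s" by (simp add: algebra_simps)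
  then show ?thesis
    using osculating_tangent_meet[OF three assms(2)] x
    by (simp add: osculating_plane_eq_hyperplane mem_hyperplane)
qed

text \<open>The tangent at \<open>a\<close> meets the osculating plane at \<open>b\<close> in a
  point of the axis. If the axis lay in a third osculating plane, this tangent point would be on two
  osculating planes other than its own.\<close>

lemma Int_osculating_planes_subset:
  assumes three: "(3::'a::{field,finite}) \<noteq> 0" and "a \<noteq> b"
    and "osculating_plane a \<inter> osculating_plane b \<subseteq> osculating_plane (t :: 'a option)"
  shows "t = a \<or> t = b"
proof (rule ccontr)
  assume t: "\<not> (t = a \<or> t = b)"
  obtain x where x: "x \<noteq> 0" "x \<in> tangent a" "x \<in> osculating_plane b"
    using ex_nonzero_tangent_Int_hyperplane[of a "osc_vec b"]
    unfolding osculating_plane_eq_hyperplane by blast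
  moreover have "x \<in> osculating_plane t"
    using x assms(3) tangent_subset_osculating_plane by blast
  ultimately show False
    using tangent_Int_osculating_planes[OF three, of a b t x] t assms(2) by auto
qed

lemma Int_osculating_planes_in_lines:
  "a \<noteq> b \<Longrightarrow> osculating_plane a \<inter> osculating_plane b \<in> (lines :: ('a::{field,finite} ^ 4) set set)"
  using inj_osculating_plane
  by (intro Int_planes osculating_plane_in_planes) (auto dest: injD)

text \<open>A real axis in the plane would meet the tangent in the plane in a point on three osculating planes.\<close>

lemma no_real_axis_in_two_point_plane:
  assumes three: "(3::'a::{field,finite}) \<noteq> 0" and H: "H \<in> (dC_planes 2 :: ('a ^ 4) set set)"
    and "a \<noteq> b"
  shows "\<not> osculating_plane a \<inter> osculating_plane b \<subseteq> H"
proof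
  assume sub: "osculating_plane a \<inter> osculating_plane b \<subseteq> H"
  have Hp: "H \<in> planes" and ne: "H \<noteq> osculating_plane t" for t
    using H dC_planes_not_Gamma[OF _ H] by (auto simp: dC_planes_eq Gamma_planes_def)
  note L = Int_osculating_planes_in_lines[OF assms(3)]
  have eq: "osculating_plane a \<inter> osculating_plane b = H \<inter> osculating_plane a"
    "osculating_plane a \<inter> osculating_plane b = H \<inter> osculating_plane b"
    using sub by (intro lines_subset_eq[OF L plane_Int_osculating_plane(1)[OF Hp ne]]; blast)+
  obtain s where s: "tangent s \<subseteq> H" using two_point_plane_tangent[OF H] by blast
  have st: "H \<inter> osculating_plane s = tangent s"
    using s plane_Int_osculating_plane(2)[OF Hp ne] by blast
  have tan: "r = s" if "tangent s \<subseteq> osculating_plane r" for r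
    using that by (metis point_in_tangent point_vec_in_osculating_plane subsetD)
  \<comment> \<open>If \<open>s\<close> were \<open>a\<close> or \<open>b\<close>, the axis would be
    the tangent at \<open>s\<close>, which would then lie in the other osculating plane; that plane
    misses the curve point at \<open>s\<close>.\<close>
  have "s \<noteq> a" using st eq(1) tan[of b] assms(3) by blast
  moreover have "s \<noteq> b" using st eq(2) tan[of a] assms(3) by blast
  moreover obtain x where x: "x \<noteq> 0" "x \<in> tangent s" "x \<in> osculating_plane a"
    using ex_nonzero_tangent_Int_hyperplane[of s "osc_vec a"]
    unfolding osculating_plane_eq_hyperplane by blast
  moreover have "x \<in> osculating_plane b" using x s eq by blast
  ultimately show False
    using tangent_Int_osculating_planes[OF three, of s a b x] assms(3) by auto
qed

lemma EGamma_lines_iff: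
  "l \<in> EGamma_lines \<longleftrightarrow> l \<in> lines \<and> curve_params l = {} \<and> (\<exists>t. l \<subseteq> osculating_plane t)
    \<and> (\<forall>a b. a \<noteq> b \<longrightarrow> l \<noteq> osculating_plane a \<inter> osculating_plane b)"
proof -
  have "l \<in> real_axes \<longleftrightarrow> (\<exists>a b. a \<noteq> b \<and> l = osculating_plane a \<inter> osculating_plane b)"
  proof
    assume "l \<in> real_axes"
    then obtain G1 G2 where G: "l = G1 \<inter> G2" "G1 \<noteq> G2" "G1 \<in> Gamma_planes" "G2 \<in> Gamma_planes"
      by (auto simp: real_axes_def)
    then obtain a b where ab: "G1 = osculating_plane a" "G2 = osculating_plane b"
      by (auto simp: Gamma_planes_def)
    with G have "a \<noteq> b" by auto
    with G ab show "\<exists>a b. a \<noteq> b \<and> l = osculating_plane a \<inter> osculating_plane b" by blast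
  next
    assume "\<exists>a b. a \<noteq> b \<and> l = osculating_plane a \<inter> osculating_plane b"
    then obtain a b where "a \<noteq> b" "l = osculating_plane a \<inter> osculating_plane b" by blast
    moreover from this have "osculating_plane a \<noteq> osculating_plane b"
      using inj_osculating_plane by (auto dest: injD)
    moreover have "osculating_plane a \<in> Gamma_planes" "osculating_plane b \<in> Gamma_planes"
      by (simp_all add: Gamma_planes_def)
    ultimately show "l \<in> real_axes" by (auto simp: real_axes_def)
  qed
  then show ?thesis by (auto simp: EGamma_lines_def external_lines_iff Gamma_planes_def)
qed

text \<open>A second osculating plane through the line would make it a real axis.\<close>

lemma EGamma_line_unique_osculating_plane:
  assumes l: "l \<in> (EGamma_lines :: ('a::{field,finite} ^ 4) set set)"
    "l \<subseteq> osculating_plane a" "l \<subseteq> osculating_plane b"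
  shows "a = b"
proof (rule ccontr)
  assume "a \<noteq> b"
  moreover from this have "l = osculating_plane a \<inter> osculating_plane b"
    using l by (intro lines_subset_eq Int_osculating_planes_in_lines) (auto simp: EGamma_lines_iff)
  ultimately show False using l by (auto simp: EGamma_lines_iff)
qed

text \<open>The osculating planes at the q - 1 parameters outside \<open>H\<close> cut
  \<open>H\<close> in external lines. None is a real axis; a coincidence of two of them would be a
  real axis in \<open>H\<close>, so they are also distinct.\<close>

lemma card_EGamma_lines_in_two_point_plane:
  assumes three: "(3::'a::{field,finite}) \<noteq> 0" and H: "H \<in> (dC_planes 2 :: ('a ^ 4) set set)"
  shows "card {l \<in> EGamma_lines. l \<subseteq> H} = CARD('a) - 1"
proof -
  have Hp: "H \<in> planes" and ne: "H \<noteq> osculating_plane t" for t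
    using H dC_planes_not_Gamma[OF _ H] by (auto simp: dC_planes_eq Gamma_planes_def)
  note Int = plane_Int_osculating_plane[OF Hp ne]
  have "{l \<in> EGamma_lines. l \<subseteq> H} = (\<lambda>t. H \<inter> osculating_plane t) ` (- curve_params H)"
  proof (intro set_eqI iffI)
    fix l assume l: "l \<in> {l \<in> EGamma_lines. l \<subseteq> H}"
    then obtain t where t: "l \<subseteq> osculating_plane t" "l \<in> lines" "curve_params l = {}"
      by (auto simp: EGamma_lines_iff)
    then have eq: "l = H \<inter> osculating_plane t" using l lines_subset_eq[OF t(2) Int(1)] by auto
    then have "t \<in> - curve_params H" using Int(3)[of t] t by auto
    with eq show "l \<in> (\<lambda>t. H \<inter> osculating_plane t) ` (- curve_params H)" by blast
  next
    fix l assume "l \<in> (\<lambda>t. H \<inter> osculating_plane t) ` (- curve_params H)"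
    then obtain t where t: "t \<notin> curve_params H" "l = H \<inter> osculating_plane t" by blast
    moreover have "l \<noteq> osculating_plane a \<inter> osculating_plane b" if "a \<noteq> b" for a b
      using no_real_axis_in_two_point_plane[OF three H that] t by blast
    ultimately show "l \<in> {l \<in> EGamma_lines. l \<subseteq> H}"
      using Int(1,3)[of t] by (auto simp: EGamma_lines_iff)
  qed
  moreover have "inj_on (\<lambda>t. H \<inter> osculating_plane t) (- curve_params H)"
  proof (rule inj_onI, rule ccontr)
    fix s t assume st: "H \<inter> osculating_plane s = H \<inter> osculating_plane t" "s \<noteq> t"
    then have "H \<inter> osculating_plane s \<subseteq> osculating_plane s \<inter> osculating_plane t" by blast
    then have "H \<inter> osculating_plane s = osculating_plane s \<inter> osculating_plane t"
      by (rule lines_subset_eq[OF Int(1) Int_osculating_planes_in_lines[OF st(2)]])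
    then show False using no_real_axis_in_two_point_plane[OF three H st(2)] by blast
  qed
  ultimately show ?thesis
    using H by (simp add: card_image Compl_eq_Diff_UNIV card_Diff_subset CARD_option dC_planes_eq)
qed

text \<open>Of the q^2 + q + 1 lines in an osculating plane, q + 1 pass through its curve point and
  q are real axes; the other q^2 - q are the EGamma-lines. Summing over the planes counts each
  EGamma-line once.\<close>

lemma card_EGamma_lines:
  assumes three: "(3::'a::{field,finite}) \<noteq> 0"
  shows "card (EGamma_lines :: ('a ^ 4) set set) = (CARD('a) + 1) * (CARD('a) ^ 2 - CARD('a))"
proof -
  have "card {l \<in> EGamma_lines. l \<subseteq> osculating_plane t} = CARD('a) ^ 2 - CARD('a)" for t :: "'a option"
  proof -
    let ?E = "{l \<in> EGamma_lines. l \<subseteq> osculating_plane t}"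
    let ?U = "{l \<in> lines. point_vec t \<in> l \<and> l \<subseteq> osculating_plane t}"
    let ?A = "(\<lambda>s. osculating_plane t \<inter> osculating_plane s) ` (UNIV - {t})"
    have A: "l \<in> lines \<and> l \<subseteq> osculating_plane t \<and> curve_params l = {}" if "l \<in> ?A" for l
      using that Int_osculating_planes_in_lines[of t]
      by (auto simp: curve_params_Int curve_params_osculating_plane)
    have "{l \<in> lines. l \<subseteq> osculating_plane t} = (?U \<union> ?A) \<union> ?E"
    proof (intro set_eqI iffI)
      fix l assume l: "l \<in> {l \<in> lines. l \<subseteq> osculating_plane t}"
      show "l \<in> (?U \<union> ?A) \<union> ?E"
      proof (cases "l \<in> ?U \<or> l \<in> ?E")
        case False
        have "curve_params l = {}"
          using False l curve_params_mono[of l "osculating_plane t"]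
          by (auto simp: curve_params_osculating_plane curve_params_def[of l])
        with False l obtain a b where ab: "a \<noteq> b" "l = osculating_plane a \<inter> osculating_plane b"
          by (auto simp: EGamma_lines_iff)
        \<comment> \<open>In characteristic different from 3 an axis lies in no third osculating
          plane, so this one is cut out by the plane at \<open>t\<close> itself.\<close>
        then have "t = a \<or> t = b" using Int_osculating_planes_subset[OF three ab(1)] l by blast
        then have "l \<in> ?A" using ab by blast
        then show ?thesis by blast
      qed blast
    qed (use A in \<open>auto simp: EGamma_lines_iff\<close>)
    also have "card \<dots> = card (?U \<union> ?A) + card ?E"
    proof (intro card_Un_disjoint equals0I)
      fix l assume l: "l \<in> (?U \<union> ?A) \<inter> ?E"
      then have "l \<notin> ?U" by (auto simp: EGamma_lines_iff curve_params_def)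
      with l obtain s where "s \<noteq> t" "l = osculating_plane t \<inter> osculating_plane s" by blast
      with l show False by (auto simp: EGamma_lines_iff)
    qed auto
    also have "card (?U \<union> ?A) = card ?U + card ?A"
      using A by (intro card_Un_disjoint equals0I) (auto simp: curve_params_def)
    also have "card ?U = CARD('a) + 1"
      by (intro card_lines_through_in_plane osculating_plane_in_planes point_vec_nonzero)
        (simp add: point_vec_in_osculating_plane)
    also have "card {l \<in> lines. l \<subseteq> osculating_plane t} = CARD('a) ^ 2 + CARD('a) + 1"
      by (intro card_lines_in_plane osculating_plane_in_planes)
    also have "card ?A = CARD('a)"
    proof -
      have "inj_on (\<lambda>s. osculating_plane t \<inter> osculating_plane s) (UNIV - {t})"
      proof (rule inj_onI)
        fix r s assume rs: "r \<in> UNIV - {t}" "s \<in> UNIV - {t}"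
          "osculating_plane t \<inter> osculating_plane r = osculating_plane t \<inter> osculating_plane s"
        then show "r = s" using Int_osculating_planes_subset[OF three, of t r s] by blast
      qed
      then show ?thesis by (simp add: card_image CARD_option)
    qed
    finally show ?thesis by simp
  qed
  moreover have "(\<Sum>t\<in>UNIV. card {l \<in> (EGamma_lines :: ('a ^ 4) set set). l \<subseteq> osculating_plane t})
      = 1 * card (EGamma_lines :: ('a ^ 4) set set)"
  proof (intro sum_multicount ballI)
    fix l :: "('a ^ 4) set" assume l: "l \<in> EGamma_lines"
    then obtain t where "l \<subseteq> osculating_plane t" by (auto simp: EGamma_lines_iff)
    then have "{t \<in> UNIV. l \<subseteq> osculating_plane t} = {t}"
      using EGamma_line_unique_osculating_plane[OF l] by auto
    then show "card {t \<in> UNIV. l \<subseteq> osculating_plane t} = 1" by simp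
  qed auto
  ultimately show ?thesis by (simp add: CARD_option)
qed

text \<open>If 3 = 0, the triples \<open>{x, x + 1, x + 2}\<close> partition the field into classes
  of size 3, so 3 divides q.\<close>

lemma three_neq_0:
  assumes "CARD('a::{field,finite}) mod 3 \<noteq> 0"
  shows "(3::'a) \<noteq> 0"
proof
  assume three: "(3::'a) = 0"
  let ?C = "range (\<lambda>x::'a. {x, x + 1, x + 2})"
  have "(2::'a) \<noteq> 0"
  proof
    assume "(2::'a) = 0"
    moreover have "(1::'a) = 3 - 2" by simp
    ultimately have "(1::'a) = 0" using three by simp
    then show False by simp
  qed
  moreover have "(1::'a) \<noteq> 2"
  proof
    assume "(1::'a) = 2"
    then have "1 + 0 = 1 + (1::'a)" by simp
    then show False by (simp only: add_left_cancel) simp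
  qed
  ultimately have card: "card {x, x + 1, x + 2} = 3" for x :: 'a by simp
  have wrap: "x + 1 + 2 = x" "x + 2 + 1 = x" "x + 2 + 2 = x + 1" for x :: 'a
  proof -
    have "x + 1 + 2 = x + 3" "x + 2 + 1 = x + 3" "x + 2 + 2 = x + 1 + 3" by simp_all
    then show "x + 1 + 2 = x" "x + 2 + 1 = x" "x + 2 + 2 = x + 1" using three by simp_all
  qed
  have eq: "{y, y + 1, y + 2} = {x, x + 1, x + 2}" if "y \<in> {x, x + 1, x + 2}" for x y :: 'a
    using that wrap[of x] by (auto simp: add.assoc)
  have "3 dvd card (\<Union>?C)"
  proof (rule dvd_partition)
    show "\<forall>c1\<in>?C. \<forall>c2\<in>?C. c1 \<noteq> c2 \<longrightarrow> c1 \<inter> c2 = {}"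
    proof (intro ballI impI equals0I)
      fix c1 c2 y assume c: "c1 \<in> ?C" "c2 \<in> ?C" "c1 \<noteq> c2" "y \<in> c1 \<inter> c2"
      then obtain x1 x2 where "c1 = {x1, x1 + 1, x1 + 2}" "c2 = {x2, x2 + 1, x2 + 2}" by blast
      with c eq[of y x1] eq[of y x2] show False by simp
    qed
  qed (use card in auto)
  moreover have "\<Union>?C = UNIV" by blast
  ultimately show False using assms by (simp add: dvd_eq_mod_eq_0)
qed

section \<open>Planes through a real chord, and the assembly of the counts\<close>

lemma two_point_plane_Int_osculating_planes:
  fixes H :: "('a::{field,finite} ^ 4) set"
  assumes H: "H \<in> dC_planes 2" and t: "curve_params H = {t1, t2}" "tangent t1 \<subseteq> H" "t1 \<noteq> t2"
  shows "H \<inter> osculating_plane t1 = tangent t1" "H \<inter> osculating_plane t2 \<in> unisecants - T_lines"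
proof -
  have Hp: "H \<in> planes" and ne: "H \<noteq> osculating_plane t" for t
    using H dC_planes_not_Gamma[OF _ H] by (auto simp: dC_planes_eq Gamma_planes_def)
  note Int = plane_Int_osculating_plane[OF Hp ne]
  show "H \<inter> osculating_plane t1 = tangent t1" using Int(2) t by blast
  have p: "curve_params (H \<inter> osculating_plane t2) = {t2}" using Int(3)[of t2] t by auto
  have "H \<inter> osculating_plane t2 \<noteq> tangent s" for s
  proof
    assume eq: "H \<inter> osculating_plane t2 = tangent s"
    then have "s = t2" using p curve_params_tangent[of s] by simp
    \<comment> \<open>The 2_C-plane \<open>H\<close> would contain a second tangent.\<close>
    then have "tangent t2 \<subseteq> H" using eq by blast
    then show False using two_point_plane_tangent[OF H] t by blast
  qed
  then show "H \<inter> osculating_plane t2 \<in> unisecants - T_lines"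
    using p Int(1) by (auto simp: unisecants_iff T_lines_def)
qed

theorem theorem5p5:
  fixes q :: nat
  assumes "q = CARD('a::{field,finite})"
    and "q \<ge> 5"
  shows
    "(\<forall>R \<in> real_chords. \<forall>t1 t2 :: 'a option.
        curve_point t1 \<noteq> curve_point t2 \<and> curve_points_in R = {curve_point t1, curve_point t2} \<longrightarrow>
        (\<forall>H \<in> dC_planes 2. R \<subseteq> H \<longrightarrow>
           (H \<inter> osculating_plane t1 = tangent t1 \<and>
            H \<inter> osculating_plane t2 \<in> unisecants - T_lines) \<or>
           (H \<inter> osculating_plane t2 = tangent t2 \<and>
            H \<inter> osculating_plane t1 \<in> unisecants - T_lines))) \<and>
     has_Lambda TYPE('a) T_lines (dC_planes 2) 1 \<and>
     has_Lambda TYPE('a) UGamma_lines (dC_planes 2) 1 \<and>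
     avg_Pi TYPE('a) (dC_planes 2) UGamma_lines = 1 \<and>
     has_Lambda TYPE('a) UGamma_lines bar1C_planes 1 \<and>
     avg_Pi TYPE('a) bar1C_planes UGamma_lines = (real q - 1) / 2 \<and>
     avg_Pi TYPE('a) (dC_planes 3) UGamma_lines = (real q - 1) / 2 \<and>
     has_Lambda TYPE('a) UGamma_lines (dC_planes 3) 3 \<and>
     has_Lambda TYPE('a) UnGamma_lines (dC_planes 2) (2 * (q - 1)) \<and>
     avg_Pi TYPE('a) (dC_planes 2) UnGamma_lines = 2 \<and>
     (q mod 3 \<noteq> 0 \<longrightarrow>
        avg_Pi TYPE('a) (dC_planes 2) EGamma_lines = 1 \<and>
        has_Lambda TYPE('a) EGamma_lines (dC_planes 2) (q - 1)) \<and>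
     (\<forall>l \<in> (T_lines :: ('a ^ 4) set set).
        card {H \<in> dC_planes 2. l \<subseteq> H} = q \<and>
        \<not> (\<exists>H \<in> dC_planes 3 \<union> bar1C_planes \<union> dC_planes 0. l \<subseteq> H)) \<and>
     avg_Pi TYPE('a) (dC_planes 2) T_lines = real q \<and>
     (\<forall>P \<in> {dC_planes 3, bar1C_planes, dC_planes 0}.
        has_Lambda TYPE('a) T_lines P 0 \<and> avg_Pi TYPE('a) P T_lines = 0)"
proof -
  have q: "5 \<le> CARD('a)" and q_def: "q = CARD('a)" using assms by auto
  let ?two = "dC_planes 2 :: ('a ^ 4) set set" and ?three = "dC_planes 3 :: ('a ^ 4) set set"
    and ?zero = "dC_planes 0 :: ('a ^ 4) set set" and ?one = "bar1C_planes :: ('a ^ 4) set set"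
  have pos: "0 < (real CARD('a) + 1) * real CARD('a) * (real CARD('a) - 1)"
    "0 < (real CARD('a) + 1) * real CARD('a)"
    using q by simp_all
  \<comment> \<open>\<open>has_Lambda\<close> demands a nonempty class of planes, which the explicit
    counts provide.\<close>
  have "0 < real (card ?two)" "0 < real (card ?three)" "0 < real (card ?one)" "0 < real (card ?zero)"
    unfolding plane_type_counts using pos by simp_all
  then have nonempty: "?two \<noteq> {}" "?three \<noteq> {}" "?one \<noteq> {}" "?zero \<noteq> {}" by auto
  have T2: "card {l \<in> T_lines. l \<subseteq> H} = 1" if "H \<in> ?two" for H
    using that by (simp add: card_T_lines_in card_tangents_in_two_point_plane)
  have T0: "card {l \<in> T_lines. l \<subseteq> H} = 0" if "H \<in> ?three \<union> ?one \<union> ?zero" for H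
    using no_tangent_in_plane[OF that] by (simp add: card_T_lines_in)
  have U2: "card {l \<in> UGamma_lines. l \<subseteq> H} = 1" if "H \<in> ?two" for H
    using that dC_planes_not_Gamma[OF _ that] card_UGamma_lines_in_plane[of H]
      card_tangents_in_two_point_plane[OF that]
    by (simp add: dC_planes_eq)
  have U1: "card {l \<in> UGamma_lines. l \<subseteq> H} = 1" if "H \<in> ?one" for H
    using that card_UGamma_lines_in_plane[of H] no_tangent_in_plane[of H]
    by (simp add: dC_planes_eq bar1C_planes_eq)
  have U3: "card {l \<in> UGamma_lines. l \<subseteq> H} = 3" if "H \<in> ?three" for H
    using that dC_planes_not_Gamma[OF _ that] card_UGamma_lines_in_plane[of H] no_tangent_in_plane[of H]
    by (simp add: dC_planes_eq)
  have Un2: "card {l \<in> UnGamma_lines. l \<subseteq> H} = 2 * (CARD('a) - 1)" if "H \<in> ?two" for H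
  proof -
    have "H \<in> planes" "card (curve_params H) = 2" using that by (simp_all add: dC_planes_eq)
    \<comment> \<open>Each of the two curve points is on q + 1 lines of \<open>H\<close>, one of
      them the common chord. One tangent and one UGamma-line then leave 2 q - 2.\<close>
    then have "card {l \<in> unisecants. l \<subseteq> H} = 2 * CARD('a)" by (simp add: card_unisecants_in_plane)
    then show ?thesis using card_unisecants_split[of H] T2[OF that] U2[OF that] by simp
  qed
  have chord: "(H \<inter> osculating_plane t1 = tangent t1 \<and> H \<inter> osculating_plane t2 \<in> unisecants - T_lines) \<or>
      (H \<inter> osculating_plane t2 = tangent t2 \<and> H \<inter> osculating_plane t1 \<in> unisecants - T_lines)"
    if hyp: "curve_point t1 \<noteq> curve_point t2" "curve_points_in R = {curve_point t1, curve_point t2}"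
      "H \<in> ?two" "R \<subseteq> H" for R H and t1 t2 :: "'a option"
  proof -
    have sub: "vec.subspace H" and H: "card (curve_params H) = 2"
      using hyp(3) by (auto simp: dC_planes_eq subspace_planes)
    have "curve_point t1 \<subseteq> R" "curve_point t2 \<subseteq> R"
      using hyp(2) unfolding curve_points_in_def by blast+
    then have "t1 \<in> curve_params H" "t2 \<in> curve_params H"
      using hyp(4) sub by (auto simp: curve_point_eq_span curve_params_def intro: vec.span_base)
    moreover have "t1 \<noteq> t2" using hyp(1) by blast
    \<comment> \<open>The two curve points of the chord are already all the curve points of
      \<open>H\<close>, so the tangent in \<open>H\<close> touches at one of them.\<close>
    ultimately have t: "curve_params H = {t1, t2}"
      using H card_subset_eq[of "curve_params H" "{t1, t2}"] by simp
    obtain t where "tangent t \<subseteq> H" using two_point_plane_tangent[OF hyp(3)] by blast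
    then have "tangent t1 \<subseteq> H \<or> tangent t2 \<subseteq> H"
      using t point_in_tangent[of t] by (auto simp: curve_params_def set_eq_iff)
    then show ?thesis
      using two_point_plane_Int_osculating_planes[OF hyp(3) t _ \<open>t1 \<noteq> t2\<close>]
        two_point_plane_Int_osculating_planes[OF hyp(3), of t2 t1] t \<open>t1 \<noteq> t2\<close>
      by (auto simp: insert_commute)
  qed
  define r where "r = real CARD('a)"
  have r: "r \<noteq> 0" "r + 1 \<noteq> 0" "r - 1 \<noteq> 0" using q by (auto simp: r_def)
  have "2 * r + 2 \<noteq> 0" using r(2) by linarith
  have sq: "real (CARD('a) ^ 2 - CARD('a)) = r * (r - 1)" "real (CARD('a) - 1) = r - 1"
    using q by (simp_all add: r_def of_nat_diff power2_eq_square algebra_simps)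
  have cards: "real (card (T_lines :: ('a ^ 4) set set)) = r + 1"
    "real (card (UGamma_lines :: ('a ^ 4) set set)) = (r + 1) * r"
    "real (card (UnGamma_lines :: ('a ^ 4) set set)) = (r + 1) * (r * (r - 1))"
    unfolding card_T_lines card_UGamma_lines card_UnGamma_lines of_nat_mult sq
    by (simp_all add: r_def)
  have Lambda: "has_Lambda TYPE('a) T_lines ?two 1" "has_Lambda TYPE('a) UGamma_lines ?two 1"
    "has_Lambda TYPE('a) UGamma_lines ?one 1" "has_Lambda TYPE('a) UGamma_lines ?three 3"
    "has_Lambda TYPE('a) UnGamma_lines ?two (2 * (q - 1))"
    using T2 U2 U1 U3 Un2 nonempty by (simp_all add: has_Lambda_def q_def)
  have avg_U: "avg_Pi TYPE('a) ?two UGamma_lines = 1"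
    "avg_Pi TYPE('a) ?one UGamma_lines = (real q - 1) / 2"
    "avg_Pi TYPE('a) ?three UGamma_lines = (real q - 1) / 2"
    unfolding avg_Pi_eq[OF Lambda(2)] avg_Pi_eq[OF Lambda(3)] avg_Pi_eq[OF Lambda(4)] plane_type_counts cards q_def r_def[symmetric]
    using r \<open>2 * r + 2 \<noteq> 0\<close> by (simp_all add: divide_simps)
  have avg_Un: "avg_Pi TYPE('a) ?two UnGamma_lines = 2"
    unfolding avg_Pi_eq[OF Lambda(5)] plane_type_counts cards q_def of_nat_mult sq r_def[symmetric]
    using r by (simp add: divide_simps)
  have EG: "avg_Pi TYPE('a) ?two EGamma_lines = 1 \<and> has_Lambda TYPE('a) EGamma_lines ?two (q - 1)"
    if "q mod 3 \<noteq> 0"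
  proof -
    have three: "(3::'a) \<noteq> 0" using that three_neq_0 by (simp add: q_def)
    have E2: "has_Lambda TYPE('a) EGamma_lines ?two (q - 1)"
      using card_EGamma_lines_in_two_point_plane[OF three] nonempty by (simp add: has_Lambda_def q_def)
    have card_E: "real (card (EGamma_lines :: ('a ^ 4) set set)) = (r + 1) * (r * (r - 1))"
      unfolding card_EGamma_lines[OF three] of_nat_mult sq by (simp add: r_def)
    have "avg_Pi TYPE('a) ?two EGamma_lines = 1"
      unfolding avg_Pi_eq[OF E2] plane_type_counts card_E q_def sq r_def[symmetric]
      using r by simp
    with E2 show ?thesis by simp
  qed
  have T: "card {H \<in> ?two. l \<subseteq> H} = q \<and> \<not> (\<exists>H \<in> ?three \<union> ?one \<union> ?zero. l \<subseteq> H)"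
    if "l \<in> T_lines" for l
    using that no_tangent_in_plane card_two_point_planes_through_tangent q_def
    by (auto simp: T_lines_def)
  have avg_T: "avg_Pi TYPE('a) ?two T_lines = real q"
    unfolding avg_Pi_eq[OF Lambda(1)] plane_type_counts cards q_def r_def[symmetric]
    using r by simp
  have T0': "has_Lambda TYPE('a) T_lines P 0 \<and> avg_Pi TYPE('a) P T_lines = 0"
    if "P \<in> {?three, ?one, ?zero}" for P
  proof -
    have P: "P \<noteq> {}" "P \<subseteq> ?three \<union> ?one \<union> ?zero" using that nonempty by auto
    have L: "has_Lambda TYPE('a) T_lines P 0"
      unfolding has_Lambda_def by (intro conjI P(1) ballI T0 subsetD[OF P(2)])
    then show ?thesis by (simp add: avg_Pi_eq[OF L])
  qed
  have part_i: "\<forall>R \<in> real_chords. \<forall>t1 t2 :: 'a option.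
      curve_point t1 \<noteq> curve_point t2 \<and> curve_points_in R = {curve_point t1, curve_point t2} \<longrightarrow>
      (\<forall>H \<in> ?two. R \<subseteq> H \<longrightarrow>
         (H \<inter> osculating_plane t1 = tangent t1 \<and> H \<inter> osculating_plane t2 \<in> unisecants - T_lines) \<or>
         (H \<inter> osculating_plane t2 = tangent t2 \<and> H \<inter> osculating_plane t1 \<in> unisecants - T_lines))"
    by (intro ballI allI impI, elim conjE, rule chord)
  show ?thesis
    by (intro conjI part_i Lambda avg_U avg_Un avg_T impI[OF EG] ballI[OF T] ballI[OF T0'])
qed

end
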